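(* Assume $\operatorname{zer}(A+B)\neq\varnothing$, that $\operatorname{dom}(A)$ is bounded, and that $A$ or $B$ is uniformly monotone. Let $(\gamma_n)$ be a monotone decreasing sequence in $\big]0,\frac{\sqrt2-1}{\mu}\big[$ such that $$\sum_n\gamma_n^2<+\infty,\qquad\sum_n\gamma_n=+\infty,\qquad\sum_{n\in\mathbb N}\gamma_n^2\,\mathsf E\big[\|r_n-By_n\|^2\mid\mathcal F_n\big]<+\infty\ \text{a.s.},$$ and let $(x_n)$ be generated by the reflected stochastic forward–backward iteration with these step sizes. Then $(x_n)$ converges strongly almost surely to the unique solution $\bar x$ of $0\in A\bar x+B\bar x$.
   Context: $\mathcal H$ is a separable real Hilbert space; $(\Omega,\mathcal F,\mathsf P)$ a probability space. $A:\mathcal H\to2^{\mathcal H}$ is maximally monotone; $B:\mathcal H\to\mathcal H$ is monotone and $\mu$-Lipschitz continuous ($\mu>0$); $\operatorname{zer}(A+B)=\{x:0\in Ax+Bx\}$; $\operatorname{dom}(A)=\{x:Ax\neq\varnothing\}$. An operator $M$ is uniformly monotone if there is an increasing $\phi:[0,\infty[\to[0,\infty]$ vanishing only at $0$ with $\langle x-y,u-v\rangle\ge\phi(\|x-y\|)$ for all $(x,u),(y,v)\in\operatorname{gra}M$. $J_{\gamma A}=(\mathrm{Id}+\gamma A)^{-1}$. Reflected stochastic forward–backward iteration: $(\gamma_n)_{n\ge-1}$ is a sequence in $]0,+\infty[$, $x_0,x_{-1}$ are square-integrable $\mathcal H$-valued random variables, and for every $n\in\mathbb N$: $y_n=2x_n-x_{n-1}$;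 $r_n$ is an $\mathcal H$-valued random variable with $\mathsf E[r_n\mid\mathcal F_n]=By_n$, where $\mathcal F_n=\sigma(x_0,\dots,x_n)$; and $x_{n+1}=J_{\gamma_nA}(x_n-\gamma_nr_n)$. *)

theory Defs
  imports "HOL-Analysis.Analysis" "HOL-Probability.Probability"
begin

definition monotone_op :: "('a::real_inner \<Rightarrow> 'a set) \<Rightarrow> bool" where
  "monotone_op A \<longleftrightarrow>
     (\<forall>x y u v. u \<in> A x \<longrightarrow> v \<in> A y \<longrightarrow> inner (x - y) (u - v) \<ge> 0)"

definition maximally_monotone :: "('a::real_inner \<Rightarrow> 'a set) \<Rightarrow> bool" where
  "maximally_monotone A \<longleftrightarrow> monotone_op A \<and>
     (\<forall>x u. (\<forall>y v. v \<in> A y \<longrightarrow> inner (x - y) (u - v) \<ge> 0) \<longrightarrow> u \<in> A x)"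

definition uniformly_monotone :: "('a::real_inner \<Rightarrow> 'a set) \<Rightarrow> bool" where
  "uniformly_monotone M \<longleftrightarrow>
     (\<exists>\<phi> :: real \<Rightarrow> ereal.
        mono_on {0..} \<phi> \<and> (\<forall>t\<ge>0. \<phi> t \<ge> 0) \<and> (\<forall>t\<ge>0. \<phi> t = 0 \<longleftrightarrow> t = 0) \<and>
        (\<forall>x y u v. u \<in> M x \<longrightarrow> v \<in> M y \<longrightarrow>
            ereal (inner (x - y) (u - v)) \<ge> \<phi> (norm (x - y))))"

definition single_op :: "('a \<Rightarrow> 'a) \<Rightarrow> ('a \<Rightarrow> 'a set)" where
  "single_op B = (\<lambda>x. {B x})"

definition dom_op :: "('a \<Rightarrow> 'b set) \<Rightarrow> 'a set" where
  "dom_op A = {x. A x \<noteq> {}}"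

definition zer_sum :: "('a::real_vector \<Rightarrow> 'a set) \<Rightarrow> ('a \<Rightarrow> 'a) \<Rightarrow> 'a set" where
  "zer_sum A B = {x. \<exists>u \<in> A x. u + B x = 0}"

text \<open>Resolvent J_{gamma A} = (Id + gamma A)^{-1}: J z is the point p with z in p + gamma A p
  (single-valued for monotone A, everywhere defined for maximally monotone A).\<close>
definition resolvent :: "real \<Rightarrow> ('a::real_inner \<Rightarrow> 'a set) \<Rightarrow> 'a \<Rightarrow> 'a" where
  "resolvent \<gamma> A z = (THE p. \<exists>u \<in> A p. z = p + \<gamma> *\<^sub>R u)"

definition gen_filtration :: "'w measure \<Rightarrow> (nat \<Rightarrow> 'w \<Rightarrow> 'a::topological_space) \<Rightarrow> nat \<Rightarrow> 'w measure" where
  "gen_filtration M X n =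
     sigma (space M) (\<Union>i\<in>{..n}. {X i -` U \<inter> space M | U. U \<in> sets borel})"

definition is_cond_exp ::
  "'w measure \<Rightarrow> 'w measure \<Rightarrow> ('w \<Rightarrow> 'a::{banach, second_countable_topology}) \<Rightarrow> ('w \<Rightarrow> 'a) \<Rightarrow> bool" where
  "is_cond_exp M F X Y \<longleftrightarrow> integrable M X \<and>
     (\<exists>Z. Z \<in> borel_measurable F \<and> integrable M Z \<and> (AE \<omega> in M. Y \<omega> = Z \<omega>) \<and>
          (\<forall>S \<in> sets F. (LINT \<omega>:S|M. X \<omega>) = (LINT \<omega>:S|M. Z \<omega>)))"

end

(* Let z be the zero of A + B and psi a modulus of uniform monotonicity of A + B. For
   n >= 2 the points x_{n-1}, x_n, x_{n+1} and z lie in the bounded set dom A, so the error of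
   evaluating B at the reflected point y_n instead of x_{n+1} costs only a fraction of the squared
   increments plus O(gamma_n^2), and V_n = |x_n - z|^2 + |x_n - x_{n-1}|^2 / 4 satisfies
     V_{n+1} + |x_{n+1} - x_n|^2 / 4 + 2 gamma_n psi(|x_{n+1} - z|)
       <= V_n + O(gamma_n^2) + 4 gamma_n^2 |e_n|^2 - 2 gamma_n <x_n - z, e_n>,   e_n = r_n - B y_n.
   Conditioning on F_{n+1} turns the noise terms into an almost surely summable nonnegative series
   and into martingale differences that converge almost surely after localisation. Hence
   |x_n - z|^2 converges and sum gamma_n psi(|x_{n+1} - z|) < infinity; since sum gamma_n = infinity,
   the limit is 0. *)

theory Submission
  imports Defs
begin

text \<open>The recursion is meaningful only if \<open>resolvent\<close>, a definite description,
  has a value at every point. This is Minty's theorem, reached here through a concave maximisation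
  over a convex hull. It puts every iterate after \<open>x 0\<close> into \<open>dom_op A\<close>.
  Two features of the noise shape the probabilistic part. Its hypothesis is conditional and
  pathwise, so E|e_n|^2 may be infinite and no L2 bound is available before stopping. And it enters
  through <x_{n+1} - z, e_n>, where x_{n+1} depends on e_n; splitting off <x_n - z, e_n> gives a
  conditionally centred term and a remainder that an increment absorbs. The constants come from a
  budget. Polarisation supplies -|x_{n+1} - x_n|^2. One quarter absorbs the noise remainder at the
  price 4 gamma_n^2 |e_n|^2. A second quarter, together with |x_n - x_{n-1}|^2 / 4, absorbs the
  Lipschitz error at y_n; the weight 1/4 in V_n pays for the old increment. A third quarter enters
  V_{n+1}, and the last one makes the increments vanish.\<close>

section \<open>Minty's theorem and resolvents\<close>

text \<open>For fixed \<open>(Y, Z, c)\<close> the set \<open>H Y Z c\<close> is a half-space in the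
  primed triple, and for two graph triples its defining expression equals
  \<open>inner (y - y') (a - a')\<close>. The expression is symmetric in the two triples, so the
  inequality passes to the hull in one argument and then in the other. With both triples equal it
  reads \<open>2 * c - 2 * inner Y Z \<le> 0\<close>.\<close>

lemma convex_hull_antimonotone_graph:
  fixes G :: "('a::real_inner \<times> 'a) set"
  assumes anti: "\<And>y a y' a'. (y, a) \<in> G \<Longrightarrow> (y', a') \<in> G \<Longrightarrow> inner (y - y') (a - a') \<le> 0"
    and mem: "(Y, Z, c) \<in> convex hull ((\<lambda>(y, a). (y, a, inner y a)) ` G)"
  shows "c \<le> inner Y Z"
proof -
  let ?S = "(\<lambda>(y, a). (y, a, inner y a)) ` G"
  define H where "H Y Z c = {(Y', Z', c'). c' + c - inner Y Z' - inner Y' Z \<le> 0}" for Y Z :: 'a and c :: real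
  have conv: "convex (H Y Z c)" for Y Z c
  proof (rule convexI)
    fix s t :: "'a \<times> 'a \<times> real" and u v :: real
    assume st: "s \<in> H Y Z c" "t \<in> H Y Z c" and uv: "0 \<le> u" "0 \<le> v" "u + v = 1"
    obtain Y1 Z1 c1 Y2 Z2 c2 where e: "s = (Y1, Z1, c1)" "t = (Y2, Z2, c2)"
      by (metis surj_pair)
    have "u * (c1 + c - inner Y Z1 - inner Y1 Z) + v * (c2 + c - inner Y Z2 - inner Y2 Z) \<le> 0"
      using st uv by (auto simp: e H_def intro!: add_nonpos_nonpos mult_nonneg_nonpos)
    also have "u * (c1 + c - inner Y Z1 - inner Y1 Z) + v * (c2 + c - inner Y Z2 - inner Y2 Z)
      = u * c1 + v * c2 + (u + v) * c - inner Y (u *\<^sub>R Z1 + v *\<^sub>R Z2) - inner (u *\<^sub>R Y1 + v *\<^sub>R Y2) Z"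
      by (simp add: inner_add_left inner_add_right algebra_simps)
    finally show "u *\<^sub>R s + v *\<^sub>R t \<in> H Y Z c"
      using uv by (simp add: e H_def)
  qed
  have base: "convex hull ?S \<subseteq> H y a (inner y a)" if "(y, a) \<in> G" for y a
  proof (rule hull_minimal)
    show "convex (H y a (inner y a))" by (rule conv)
    show "?S \<subseteq> H y a (inner y a)"
    proof clarify
      fix y' a' assume "(y', a') \<in> G"
      from anti[OF this that]
      show "(y', a', inner y' a') \<in> H y a (inner y a)"
        by (simp add: H_def inner_diff_left inner_diff_right)
    qed
  qed
  have "convex hull ?S \<subseteq> H Y Z c"
  proof (rule hull_minimal)
    show "convex (H Y Z c)" by (rule conv)
    show "?S \<subseteq> H Y Z c"
    proof clarify
      fix y a assume "(y, a) \<in> G"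
      from base[OF this] mem have "(Y, Z, c) \<in> H y a (inner y a)" by blast
      then show "(y, a, inner y a) \<in> H Y Z c" by (simp add: H_def)
    qed
  qed
  with mem have "(Y, Z, c) \<in> H Y Z c" by blast
  then show ?thesis by (simp add: H_def)
qed

text \<open>On the convex hull of the triples \<open>(y, a, \<langle>y, a\<rangle>)\<close> put \<open>P (Y, Z, c) = (Y + Z)/2\<close> and
  \<open>d = c - |P|\<^sup>2\<close>, a concave quadratic; then \<open>\<langle>p - y, p - a\<rangle> = |p - P|\<^sup>2 + d\<close> at each such triple. A maximising sequence of \<open>d\<close> over the convex hull has Cauchy midpoints by strict
  concavity, and first-order optimality at the limit \<open>p\<close> bounds all these inner products by the
  supremum of \<open>d\<close>, which antimonotonicity makes nonpositive.\<close>
lemma antimonotone_common_point: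
  fixes G :: "('a::{real_inner, banach} \<times> 'a) set"
  assumes ne: "G \<noteq> {}"
    and anti: "\<And>y a y' a'. (y, a) \<in> G \<Longrightarrow> (y', a') \<in> G \<Longrightarrow> inner (y - y') (a - a') \<le> 0"
  shows "\<exists>p. \<forall>(y, a) \<in> G. inner (p - y) (p - a) \<le> 0"
proof -
  define K where "K = convex hull ((\<lambda>(y, a). (y, a, inner y a)) ` G)"
  define P :: "'a \<times> 'a \<times> real \<Rightarrow> 'a" where "P = (\<lambda>(Y, Z, c). (1/2) *\<^sub>R (Y + Z))"
  define d :: "'a \<times> 'a \<times> real \<Rightarrow> real" where "d s = snd (snd s) - (norm (P s))\<^sup>2" for s
  have K_ne: "K \<noteq> {}" using ne by (simp add: K_def)
  have d_le: "d s \<le> 0" if "s \<in> K" for s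
  proof -
    obtain Y Z c where s: "s = (Y, Z, c)" by (metis surj_pair)
    have "c \<le> inner Y Z"
      using convex_hull_antimonotone_graph[OF anti, of G Y Z c] that s K_def by blast
    also have "\<dots> \<le> (norm ((1/2) *\<^sub>R (Y + Z)))\<^sup>2"
    proof -
      have "(norm ((1/2) *\<^sub>R (Y + Z)))\<^sup>2 - inner Y Z = (norm ((1/2) *\<^sub>R (Y - Z)))\<^sup>2"
        unfolding power2_norm_eq_inner
        by (simp add: inner_add_left inner_add_right inner_diff_left inner_diff_right inner_commute algebra_simps)
      then show ?thesis by (metis diff_ge_0_iff_ge zero_le_power2)
    qed
    finally show ?thesis by (simp add: d_def P_def s)
  qed
  have bdd: "bdd_above (d ` K)" using d_le by (auto intro!: bdd_aboveI[of _ 0])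
  define D where "D = Sup (d ` K)"
  have dD: "d s \<le> D" if "s \<in> K" for s
    unfolding D_def by (rule cSup_upper) (use that bdd in auto)
  have D0: "D \<le> 0" unfolding D_def by (rule cSup_least) (use K_ne d_le in auto)
  \<comment> \<open>\<open>P\<close> is linear and \<open>d\<close> is a linear functional minus
    \<open>(norm (P s))\<^sup>2\<close>, so concavity along a segment holds with an exact quadratic
    gain. The inequality serves twice: with \<open>t = 1/2\<close> for the Cauchy property and with
    small \<open>t\<close> for optimality.\<close>
  have mix: "(1 - t) * d s + t * d s' + t * (1 - t) * (norm (P s - P s'))\<^sup>2 \<le> D"
    if "s \<in> K" "s' \<in> K" "0 \<le> t" "t \<le> 1" for s s' t
  proof -
    have "(1 - t) *\<^sub>R s + t *\<^sub>R s' \<in> K"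
      using that unfolding K_def by (intro convexD[OF convex_convex_hull]) auto
    from dD[OF this] have "d ((1 - t) *\<^sub>R s + t *\<^sub>R s') \<le> D" .
    moreover have PP: "P (u *\<^sub>R s + v *\<^sub>R s') = u *\<^sub>R P s + v *\<^sub>R P s'" for u v
      by (cases s; cases s') (auto simp: P_def algebra_simps)
    have "d ((1 - t) *\<^sub>R s + t *\<^sub>R s') = (1 - t) * d s + t * d s' + t * (1 - t) * (norm (P s - P s'))\<^sup>2"
      unfolding d_def PP power2_norm_eq_inner
      by (simp add: inner_add_left inner_add_right inner_diff_left inner_diff_right inner_commute algebra_simps)
    ultimately show ?thesis by simp
  qed
  have "\<exists>s\<in>K. D - inverse (real (Suc k)) < d s" for k
  proof -
    have "D - inverse (real (Suc k)) < Sup (d ` K)" unfolding D_def by simp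
    then show ?thesis using less_cSup_iff[of "d ` K"] K_ne bdd by auto
  qed
  then obtain s where sK: "\<And>k. s k \<in> K" and sd: "\<And>k. D - inverse (real (Suc k)) < d (s k)"
    by metis
  have dlim: "(\<lambda>k. d (s k)) \<longlonglongrightarrow> D"
  proof (rule tendsto_sandwich[OF _ _ _ tendsto_const])
    show "(\<lambda>k. D - inverse (real (Suc k))) \<longlonglongrightarrow> D"
      using tendsto_diff[OF tendsto_const LIMSEQ_inverse_real_of_nat] by fastforce
  qed (use less_imp_le[OF sd] dD[OF sK] in auto)
  have "Cauchy (\<lambda>k. P (s k))"
  proof (rule metric_CauchyI)
    fix e :: real assume e: "e > 0"
    then have "e\<^sup>2 / 4 > 0" by simp
    with order_tendstoD(1)[OF dlim, of "D - e\<^sup>2 / 4"]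
    obtain N where N: "\<And>k. k \<ge> N \<Longrightarrow> d (s k) > D - e\<^sup>2 / 4"
      by (auto simp: eventually_sequentially)
    show "\<exists>N. \<forall>m\<ge>N. \<forall>n\<ge>N. dist (P (s m)) (P (s n)) < e"
    proof (intro exI allI impI)
      fix m n assume mn: "m \<ge> N" "n \<ge> N"
      have "(norm (P (s m) - P (s n)))\<^sup>2 < e\<^sup>2"
        using mix[OF sK sK, of "1/2" m n] N[OF mn(1)] N[OF mn(2)] by (simp add: field_simps)
      then show "dist (P (s m)) (P (s n)) < e"
        using e by (simp add: dist_norm power2_less_imp_less)
    qed
  qed
  \<comment> \<open>The triples \<open>s k\<close> themselves need not converge, and
    \<open>p\<close> need not be attained in \<open>K\<close>. Convergence of \<open>P (s k)\<close>
    and \<open>d (s k)\<close> suffices, because \<open>mix\<close> sees the triples only through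
    these values.\<close>
  then obtain p where p: "(\<lambda>k. P (s k)) \<longlonglongrightarrow> p"
    using Cauchy_convergent convergent_def by blast
  have "inner (p - y) (p - a) \<le> 0" if "(y, a) \<in> G" for y a
  proof -
    let ?i = "(y, a, inner y a)"
    have i: "?i \<in> K" using that unfolding K_def by (intro hull_inc) force
    \<comment> \<open>In the limit \<open>d (s k)\<close> becomes \<open>D\<close>, so
      \<open>(1 - t) * D\<close> cancels against the right-hand side and leaves
      \<open>t * D\<close>. Division by \<open>t\<close> then prepares the passage \<open>t\<close>
      to 0.\<close>
    have 1: "d ?i + (1 - t) * (norm (p - P ?i))\<^sup>2 \<le> D" if t: "0 < t" "t \<le> 1" for t
    proof -
      have "(\<lambda>k. (1 - t) * d (s k) + t * d ?i + t * (1 - t) * (norm (P (s k) - P ?i))\<^sup>2)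
        \<longlonglongrightarrow> (1 - t) * D + t * d ?i + t * (1 - t) * (norm (p - P ?i))\<^sup>2"
        by (intro tendsto_intros dlim p)
      then have "(1 - t) * D + t * d ?i + t * (1 - t) * (norm (p - P ?i))\<^sup>2 \<le> D"
        by (rule LIMSEQ_le_const2) (use mix[OF sK i] t in auto)
      then have "t * (d ?i + (1 - t) * (norm (p - P ?i))\<^sup>2) \<le> t * D"
        by (simp add: algebra_simps)
      then show ?thesis using t by simp
    qed
    have "d ?i + (norm (p - P ?i))\<^sup>2 \<le> D"
    proof (rule LIMSEQ_le_const2)
      show "(\<lambda>k. d ?i + (1 - inverse (real (Suc k))) * (norm (p - P ?i))\<^sup>2)
        \<longlonglongrightarrow> d ?i + (norm (p - P ?i))\<^sup>2"
        by (rule tendsto_eq_intros LIMSEQ_inverse_real_of_nat refl)+ simp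
    qed (use 1 in \<open>auto simp: inverse_le_1_iff intro!: exI[of _ 0]\<close>)
    with D0 have "d ?i + (norm (p - P ?i))\<^sup>2 \<le> 0" by simp
    also have "d ?i + (norm (p - P ?i))\<^sup>2 = inner (p - y) (p - a)"
      unfolding d_def P_def power2_norm_eq_inner
      by (simp add: inner_add_left inner_add_right inner_diff_left inner_diff_right inner_commute algebra_simps)
    finally show ?thesis .
  qed
  then show ?thesis by blast
qed

text \<open>The relation sending \<open>y\<close> to \<open>z - \<gamma> v\<close> with
  \<open>v\<close> in \<open>A y\<close> is antimonotone. A common point \<open>p\<close> for it
  says exactly that \<open>(z - p) / \<gamma>\<close>, placed at \<open>p\<close>, is monotonically
  related to the whole graph of \<open>A\<close>; maximality then puts it into
  \<open>A p\<close>.\<close>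

theorem minty:
  fixes A :: "'a::{real_inner, banach} \<Rightarrow> 'a set"
  assumes "maximally_monotone A" "\<gamma> > 0"
  shows "\<exists>p. \<exists>u\<in>A p. z = p + \<gamma> *\<^sub>R u"
proof -
  have mono: "\<And>x y u v. u \<in> A x \<Longrightarrow> v \<in> A y \<Longrightarrow> inner (x - y) (u - v) \<ge> 0"
    and maxi: "\<And>x u. (\<And>y v. v \<in> A y \<Longrightarrow> inner (x - y) (u - v) \<ge> 0) \<Longrightarrow> u \<in> A x"
    using assms(1) unfolding maximally_monotone_def monotone_op_def by blast+
  define G where "G = {(y, z - \<gamma> *\<^sub>R v) | y v. v \<in> A y}"
  \<comment> \<open>An empty graph is not maximal: the condition in \<open>maxi\<close> would hold
    vacuously and put 0 into \<open>A 0\<close>.\<close>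
  have "G \<noteq> {}" using maxi[of 0 0] by (auto simp: G_def)
  moreover have "inner (y - y') (a - a') \<le> 0" if yG: "(y, a) \<in> G" "(y', a') \<in> G" for y a y' a'
  proof -
    obtain v v' where v: "v \<in> A y" "a = z - \<gamma> *\<^sub>R v" "v' \<in> A y'" "a' = z - \<gamma> *\<^sub>R v'"
      using yG by (auto simp: G_def)
    have "a - a' = - (\<gamma> *\<^sub>R (v - v'))" using v by (simp add: algebra_simps)
    then show ?thesis using mono[OF v(1,3)] assms(2) by simp
  qed
  ultimately obtain p where p: "\<And>y a. (y, a) \<in> G \<Longrightarrow> inner (p - y) (p - a) \<le> 0"
    using antimonotone_common_point[of G] by blast
  have "(1 / \<gamma>) *\<^sub>R (z - p) \<in> A p"
  proof (rule maxi)
    fix y v assume "v \<in> A y"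
    then have "inner (p - y) (p - (z - \<gamma> *\<^sub>R v)) \<le> 0" by (intro p) (auto simp: G_def)
    moreover have "p - (z - \<gamma> *\<^sub>R v) = (- \<gamma>) *\<^sub>R ((1 / \<gamma>) *\<^sub>R (z - p) - v)"
      using assms(2) by (simp add: algebra_simps)
    ultimately show "0 \<le> inner (p - y) ((1 / \<gamma>) *\<^sub>R (z - p) - v)"
      using assms(2) by (simp add: zero_le_mult_iff)
  qed
  then show ?thesis using assms(2) by (intro exI bexI) auto
qed

text \<open>Firm nonexpansiveness followed by Cauchy-Schwarz. The case \<open>z = z'\<close> yields
  uniqueness of the resolvent point, so the estimate is stated for arbitrary solutions
  \<open>p\<close>, \<open>p'\<close> before \<open>resolvent\<close> is known to be well
  defined.\<close>

lemma resolvent_dist: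
  assumes A: "monotone_op A" "\<gamma> \<ge> 0"
    and "u \<in> A p" "z = p + \<gamma> *\<^sub>R u" "u' \<in> A p'" "z' = p' + \<gamma> *\<^sub>R u'"
  shows "norm (p - p') \<le> norm (z - z')"
proof -
  have "inner (p - p') (u - u') \<ge> 0" using assms unfolding monotone_op_def by blast
  then have "(norm (p - p'))\<^sup>2 \<le> inner (p - p') (p - p') + \<gamma> * inner (p - p') (u - u')"
    using A(2) by (simp add: power2_norm_eq_inner)
  also have "\<dots> = inner (p - p') (z - z')"
    using assms by (simp add: inner_add_right inner_diff_right algebra_simps)
  also have "\<dots> \<le> norm (p - p') * norm (z - z')" by (rule norm_cauchy_schwarz)
  finally show ?thesis
    by (metis mult_le_cancel_left_pos norm_ge_zero order_less_le power2_eq_square)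
qed

text \<open>Membership puts each new iterate into the bounded domain of \<open>A\<close>;
  nonexpansiveness makes the resolvent continuous, hence the iterates measurable.\<close>

lemma
  fixes A :: "'a::{real_inner, banach} \<Rightarrow> 'a set"
  assumes A: "maximally_monotone A" "\<gamma> > 0"
  shows resolvent_mem: "(1 / \<gamma>) *\<^sub>R (z - resolvent \<gamma> A z) \<in> A (resolvent \<gamma> A z)"
    and resolvent_nonexpansive: "norm (resolvent \<gamma> A z - resolvent \<gamma> A z') \<le> norm (z - z')"
proof -
  have mono: "monotone_op A" using A(1) by (simp add: maximally_monotone_def)
  have r: "\<exists>u\<in>A (resolvent \<gamma> A z). z = resolvent \<gamma> A z + \<gamma> *\<^sub>R u" for z
    unfolding resolvent_def
  proof (rule theI')
    obtain p where p: "\<exists>u\<in>A p. z = p + \<gamma> *\<^sub>R u" using minty[OF A] by blast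
    moreover have "p' = p" if "\<exists>u\<in>A p'. z = p' + \<gamma> *\<^sub>R u" for p'
      using that p resolvent_dist[OF mono, of \<gamma> _ p' z _ p z] A(2) by auto
    ultimately show "\<exists>!p. \<exists>u\<in>A p. z = p + \<gamma> *\<^sub>R u" by blast
  qed
  obtain u where u: "u \<in> A (resolvent \<gamma> A z)" "z = resolvent \<gamma> A z + \<gamma> *\<^sub>R u" using r by blast
  have "u = (1 / \<gamma>) *\<^sub>R (z - resolvent \<gamma> A z)"
    using A(2) by (subst u(2)) simp
  then show "(1 / \<gamma>) *\<^sub>R (z - resolvent \<gamma> A z) \<in> A (resolvent \<gamma> A z)" using u(1) by simp
  show "norm (resolvent \<gamma> A z - resolvent \<gamma> A z') \<le> norm (z - z')"
    using r[of z] r[of z'] resolvent_dist[OF mono, of \<gamma>] A(2) by (metis less_imp_le)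
qed

section \<open>Energy decrease of a reflected step\<close>

text \<open>Capping the extended-real modulus at 1 and extending it by 0 to negative arguments
  preserves monotonicity. The result is real-valued, Borel because it is monotone, and bounded, so
  that it can be integrated along the iterates. The operator that is merely monotone only adds a
  nonnegative inner product.\<close>

lemma uniformly_monotone_sum_real:
  fixes A :: "'a::real_inner \<Rightarrow> 'a set"
  assumes A: "monotone_op A" and B: "monotone_op (single_op B)"
    and unif: "uniformly_monotone A \<or> uniformly_monotone (single_op B)"
  obtains \<psi> :: "real \<Rightarrow> real"
  where "mono \<psi>" "\<And>t. 0 \<le> \<psi> t" "\<And>t. \<psi> t \<le> 1" "\<And>t. 0 < t \<Longrightarrow> 0 < \<psi> t"
    "\<And>x y u v. u \<in> A x \<Longrightarrow> v \<in> A y \<Longrightarrow> \<psi> (norm (x - y)) \<le> inner (x - y) ((u + B x) - (v + B y))"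
proof -
  have real_modulus: "\<exists>\<psi> :: real \<Rightarrow> real. mono \<psi> \<and> (\<forall>t. 0 \<le> \<psi> t \<and> \<psi> t \<le> 1) \<and> (\<forall>t>0. 0 < \<psi> t) \<and>
      (\<forall>x y u v. u \<in> N x \<longrightarrow> v \<in> N y \<longrightarrow> \<psi> (norm (x - y)) \<le> inner (x - y) (u - v))"
    if "uniformly_monotone N" for N :: "'a \<Rightarrow> 'a set"
  proof -
    obtain \<phi> :: "real \<Rightarrow> ereal" where \<phi>: "mono_on {0..} \<phi>" "\<And>t. t \<ge> 0 \<Longrightarrow> \<phi> t \<ge> 0"
      "\<And>t. t \<ge> 0 \<Longrightarrow> \<phi> t = 0 \<longleftrightarrow> t = 0"
      "\<And>x y u v. u \<in> N x \<Longrightarrow> v \<in> N y \<Longrightarrow> ereal (inner (x - y) (u - v)) \<ge> \<phi> (norm (x - y))"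
      using \<open>uniformly_monotone N\<close> unfolding uniformly_monotone_def by blast
    define \<psi> where "\<psi> t = real_of_ereal (min 1 (\<phi> (max 0 t)))" for t
    have \<psi>: "ereal (\<psi> t) = min 1 (\<phi> (max 0 t))" for t
      unfolding \<psi>_def using \<phi>(2)[of "max 0 t"] by (intro ereal_real') (auto simp: min_def abs_ereal_ge0)
    have "mono \<psi>"
    proof (rule monoI)
      fix s t :: real assume "s \<le> t"
      then have "\<phi> (max 0 s) \<le> \<phi> (max 0 t)" by (intro mono_onD[OF \<phi>(1)]) auto
      then have "ereal (\<psi> s) \<le> ereal (\<psi> t)" unfolding \<psi> by (rule min.mono[OF order_refl])
      then show "\<psi> s \<le> \<psi> t" by simp
    qed
    moreover have "0 \<le> \<psi> t" for t
    proof -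
      have "0 \<le> ereal (\<psi> t)" unfolding \<psi> using \<phi>(2)[of "max 0 t"] by simp
      then show ?thesis by simp
    qed
    moreover have "\<psi> t \<le> 1" for t
    proof -
      have "ereal (\<psi> t) \<le> 1" unfolding \<psi> by simp
      then show ?thesis by simp
    qed
    moreover have "0 < \<psi> t" if "t > 0" for t
    proof -
      have "0 < \<phi> t" using \<phi>(2,3)[of t] that by (simp add: order_less_le)
      then have "0 < ereal (\<psi> t)" unfolding \<psi> using that by (simp add: max_def)
      then show ?thesis by simp
    qed
    moreover have "\<psi> (norm (x - y)) \<le> inner (x - y) (u - v)" if "u \<in> N x" "v \<in> N y" for x y u v
    proof -
      have "ereal (\<psi> (norm (x - y))) \<le> ereal (inner (x - y) (u - v))"
        unfolding \<psi> using \<phi>(4)[OF that] by (simp add: min.coboundedI2)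
      then show ?thesis by simp
    qed
    ultimately show ?thesis by blast
  qed
  have A0: "0 \<le> inner (x - y) (u - v)" if "u \<in> A x" "v \<in> A y" for x y u v
    using A that unfolding monotone_op_def by blast
  have B0: "0 \<le> inner (x - y) (B x - B y)" for x y
    using B unfolding monotone_op_def single_op_def by blast
  have split: "inner (x - y) ((u + B x) - (v + B y)) = inner (x - y) (u - v) + inner (x - y) (B x - B y)"
    for x y u v by (simp add: inner_diff_right inner_add_right)
  from unif show thesis
  proof
    assume "uniformly_monotone A"
    from real_modulus[OF this] obtain \<psi> :: "real \<Rightarrow> real" where \<psi>: "mono \<psi>" "\<And>t. 0 \<le> \<psi> t" "\<And>t. \<psi> t \<le> 1"
      "\<And>t. 0 < t \<Longrightarrow> 0 < \<psi> t"
      "\<And>x y u v. u \<in> A x \<Longrightarrow> v \<in> A y \<Longrightarrow> \<psi> (norm (x - y)) \<le> inner (x - y) (u - v)" by blast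
    show thesis
    proof (rule that[OF \<psi>(1-4)])
      fix x y u v assume "u \<in> A x" "v \<in> A y"
      from \<psi>(5)[OF this] B0[of x y]
      show "\<psi> (norm (x - y)) \<le> inner (x - y) ((u + B x) - (v + B y))"
        unfolding split by linarith
    qed
  next
    assume "uniformly_monotone (single_op B)"
    from real_modulus[OF this] obtain \<psi> :: "real \<Rightarrow> real" where \<psi>: "mono \<psi>" "\<And>t. 0 \<le> \<psi> t" "\<And>t. \<psi> t \<le> 1"
      "\<And>t. 0 < t \<Longrightarrow> 0 < \<psi> t"
      "\<And>x y u v. u \<in> single_op B x \<Longrightarrow> v \<in> single_op B y \<Longrightarrow> \<psi> (norm (x - y)) \<le> inner (x - y) (u - v)"
      by blast
    show thesis
    proof (rule that[OF \<psi>(1-4)])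
      fix x y u v assume "u \<in> A x" "v \<in> A y"
      from A0[OF this] \<psi>(5)[of "B x" x "B y" y]
      show "\<psi> (norm (x - y)) \<le> inner (x - y) ((u + B x) - (v + B y))"
        unfolding split by (simp add: single_op_def)
    qed
  qed
qed

text \<open>Here \<open>q\<close>, \<open>p\<close>, \<open>p'\<close> are consecutive iterates. The
  reflected point misses \<open>p'\<close> by the difference of two consecutive increments, so the
  error \<open>f\<close> is linear in them. Since \<open>norm (p' - z)\<close> is bounded by
  \<open>D\<close>, Young's inequality trades this linear error for squared increments and a
  multiple of \<open>\<gamma>\<^sup>2\<close>.\<close>

lemma reflected_step_energy:
  fixes A :: "'a::real_inner \<Rightarrow> 'a set" and p q p' z \<rho> :: 'a
  assumes unif: "\<And>x y u v. u \<in> A x \<Longrightarrow> v \<in> A y \<Longrightarrow>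
        \<psi> (norm (x - y)) \<le> inner (x - y) ((u + B x) - (v + B y))"
    and lip: "\<And>x y. norm (B x - B y) \<le> \<mu> * norm (x - y)" and "\<mu> \<ge> 0" and "\<gamma> > 0"
    and zero: "- B z \<in> A z"
    and step: "(1 / \<gamma>) *\<^sub>R (p - \<gamma> *\<^sub>R \<rho> - p') \<in> A p'"
    and D: "norm (p' - z) \<le> D"
  defines "e \<equiv> \<rho> - B (2 *\<^sub>R p - q)"
  shows "(norm (p' - z))\<^sup>2 + (norm (p' - p))\<^sup>2 / 2 + 2 * \<gamma> * \<psi> (norm (p' - z))
    \<le> (norm (p - z))\<^sup>2 + (norm (p - q))\<^sup>2 / 4 + 8 * \<gamma>\<^sup>2 * D\<^sup>2 * \<mu>\<^sup>2
       + 4 * \<gamma>\<^sup>2 * (norm e)\<^sup>2 - 2 * \<gamma> * inner (p - z) e"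
proof -
  define f where "f = B (2 *\<^sub>R p - q) - B p'"
  define a b where "a = norm (p' - p)" and "b = norm (p - q)"
  have D0: "0 \<le> D" using D norm_ge_zero order_trans by blast
  have "\<psi> (norm (p' - z)) \<le> inner (p' - z) ((1 / \<gamma>) *\<^sub>R (p - \<gamma> *\<^sub>R \<rho> - p') + B p')"
    using unif[OF step zero] by simp
  then have "2 * \<gamma> * \<psi> (norm (p' - z)) \<le> 2 * \<gamma> * inner (p' - z) ((1 / \<gamma>) *\<^sub>R (p - \<gamma> *\<^sub>R \<rho> - p') + B p')"
    using \<open>\<gamma> > 0\<close> by simp
  also have "\<dots> = 2 * inner (p' - z) (\<gamma> *\<^sub>R ((1 / \<gamma>) *\<^sub>R (p - \<gamma> *\<^sub>R \<rho> - p') + B p'))" by simp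
  also have "\<gamma> *\<^sub>R ((1 / \<gamma>) *\<^sub>R (p - \<gamma> *\<^sub>R \<rho> - p') + B p') = (p - p') - \<gamma> *\<^sub>R e - \<gamma> *\<^sub>R f"
    using \<open>\<gamma> > 0\<close> by (simp add: e_def f_def algebra_simps)
  also have "2 * inner (p' - z) ((p - p') - \<gamma> *\<^sub>R e - \<gamma> *\<^sub>R f)
      = 2 * inner (p' - z) (p - p') - 2 * \<gamma> * inner (p - z) e - 2 * \<gamma> * inner (p' - p) e
        - 2 * \<gamma> * inner (p' - z) f"
    by (simp add: inner_diff_left inner_diff_right algebra_simps)
  finally have 1: "2 * \<gamma> * \<psi> (norm (p' - z)) \<le> 2 * inner (p' - z) (p - p') - 2 * \<gamma> * inner (p - z) e
    - 2 * \<gamma> * inner (p' - p) e - 2 * \<gamma> * inner (p' - z) f" .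
  have 2: "2 * inner (p' - z) (p - p') = (norm (p - z))\<^sup>2 - (norm (p' - z))\<^sup>2 - a\<^sup>2"
    unfolding a_def power2_norm_eq_inner
    by (simp add: inner_diff_left inner_diff_right inner_commute algebra_simps)
  have "\<gamma> * (- inner (p' - p) e) \<le> \<gamma> * (a * norm e)"
    using norm_cauchy_schwarz[of "- (p' - p)" e] \<open>\<gamma> > 0\<close> unfolding a_def norm_minus_cancel inner_minus_left
    by (intro mult_left_mono) auto
  \<comment> \<open>Expanding this square is Young's inequality with weights chosen so that exactly
    a quarter of \<open>a\<^sup>2\<close> is spent; the two squares used for \<open>f\<close> below
    follow the same pattern.\<close>
  moreover have "0 \<le> (a / 2 - 2 * \<gamma> * norm e)\<^sup>2" by simp
  ultimately have 3: "- 2 * \<gamma> * inner (p' - p) e \<le> a\<^sup>2 / 4 + 4 * \<gamma>\<^sup>2 * (norm e)\<^sup>2"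
    by (simp add: power2_diff power_mult_distrib power_divide algebra_simps)
  have "norm f \<le> \<mu> * norm (2 *\<^sub>R p - q - p')" unfolding f_def by (rule lip)
  also have "2 *\<^sub>R p - q - p' = (p - q) - (p' - p)" by (simp add: scaleR_2)
  also have "norm \<dots> \<le> a + b" unfolding a_def b_def using norm_triangle_ineq4[of "p - q" "p' - p"] by simp
  finally have f: "norm f \<le> \<mu> * (a + b)" using \<open>\<mu> \<ge> 0\<close> by (simp add: mult_left_mono)
  have "- inner (p' - z) f \<le> norm (p' - z) * norm f"
    using norm_cauchy_schwarz[of "- (p' - z)" f] unfolding norm_minus_cancel inner_minus_left .
  also have "\<dots> \<le> D * (\<mu> * (a + b))" by (intro mult_mono D f D0 norm_ge_zero)
  finally have "\<gamma> * (- inner (p' - z) f) \<le> \<gamma> * (D * (\<mu> * (a + b)))" using \<open>\<gamma> > 0\<close> by (intro mult_left_mono) auto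
  moreover have "0 \<le> (a / 2 - 2 * \<gamma> * D * \<mu>)\<^sup>2" "0 \<le> (b / 2 - 2 * \<gamma> * D * \<mu>)\<^sup>2" by simp_all
  ultimately have "- 2 * \<gamma> * inner (p' - z) f \<le> a\<^sup>2 / 4 + b\<^sup>2 / 4 + 8 * \<gamma>\<^sup>2 * D\<^sup>2 * \<mu>\<^sup>2"
    by (simp add: power2_diff power_mult_distrib power_divide algebra_simps)
  with 1 2 3 show ?thesis unfolding a_def[symmetric] b_def[symmetric] by linarith
qed

text \<open>The errors \<open>s\<close> may change sign and need not be absolutely summable, since a
  convergent martingale contributes to them. Hence the decreasing quantity is \<open>V n\<close>
  minus the partial sums of \<open>s\<close>; it is bounded because these sums are.\<close>

lemma quasi_fejer_modulus_tendsto_0: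
  fixes u \<delta> \<gamma> s :: "nat \<Rightarrow> real" and \<psi> :: "real \<Rightarrow> real"
  assumes \<psi>: "mono \<psi>" "\<And>t. 0 \<le> \<psi> t" "\<And>t. 0 < t \<Longrightarrow> 0 < \<psi> t"
    and u0: "\<And>n. 0 \<le> u n"
    and step: "\<And>n. (u (Suc n))\<^sup>2 + (\<delta> (Suc n))\<^sup>2 / 2 + 2 * \<gamma> n * \<psi> (u (Suc n))
      \<le> (u n)\<^sup>2 + (\<delta> n)\<^sup>2 / 4 + s n"
    and s: "summable s" and \<gamma>: "\<And>n. 0 < \<gamma> n" "\<not> summable \<gamma>"
  shows "u \<longlonglongrightarrow> 0"
proof -
  define V where "V n = (u n)\<^sup>2 + (\<delta> n)\<^sup>2 / 4" for n
  \<comment> \<open>Of the weight 1/2 in \<open>step\<close>, one quarter belongs to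
    \<open>V (Suc n)\<close>; the other quarter is the gain recorded here.\<close>
  define \<beta> where "\<beta> n = (\<delta> (Suc n))\<^sup>2 / 4 + 2 * \<gamma> n * \<psi> (u (Suc n))" for n
  have \<beta>0: "0 \<le> \<beta> n" for n using \<psi>(2) \<gamma>(1)[of n] by (simp add: \<beta>_def)
  have V0: "0 \<le> V n" for n by (simp add: V_def)
  have step': "V (Suc n) + \<beta> n \<le> V n + s n" for n using step[of n] by (simp add: V_def \<beta>_def)
  have sum: "V n + sum \<beta> {..<n} \<le> V 0 + sum s {..<n}" for n
  proof (induction n)
    case (Suc n)
    then show ?case using step'[of n] by simp
  qed simp
  obtain C where C: "\<And>n. \<bar>sum s {..<n}\<bar> \<le> C"
    using s[unfolded summable_iff_convergent, THEN convergent_imp_Bseq] by (auto simp: Bseq_def)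
  have sum\<beta>: "summable \<beta>"
  proof (rule summableI_nonneg_bounded[OF \<beta>0])
    show "sum \<beta> {..<n} \<le> V 0 + C" for n using sum[of n] V0[of n] C[of n] by linarith
  qed
  have "convergent (\<lambda>n. V n - sum s {..<n})"
  proof (rule Bseq_monoseq_convergent)
    show "monoseq (\<lambda>n. V n - sum s {..<n})"
      by (rule decseq_imp_monoseq, rule decseq_SucI) (use step' \<beta>0 in \<open>smt (verit) sum.lessThan_Suc\<close>)
    show "Bseq (\<lambda>n. V n - sum s {..<n})"
    proof (rule BseqI')
      fix n
      have "0 \<le> sum \<beta> {..<n}" by (intro sum_nonneg \<beta>0)
      then show "norm (V n - sum s {..<n}) \<le> V 0 + C"
        using sum[of n] V0[of n] C[of n] V0[of 0] by (auto simp: abs_le_iff)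
    qed
  qed
  then have "convergent (\<lambda>n. (V n - sum s {..<n}) + sum s {..<n})"
    by (rule convergent_add) (use s in \<open>simp add: summable_iff_convergent\<close>)
  then obtain L where L: "V \<longlonglongrightarrow> L" by (auto simp: convergent_def)
  have "summable (\<lambda>n. (\<delta> (Suc n))\<^sup>2 / 4)"
    by (rule summable_comparison_test'[OF sum\<beta>, of 0]) (use \<psi>(2) \<gamma>(1) in \<open>auto simp: \<beta>_def less_imp_le\<close>)
  then have "(\<lambda>n. (\<delta> (Suc n))\<^sup>2 / 4) \<longlonglongrightarrow> 0" by (rule summable_LIMSEQ_zero)
  then have "(\<lambda>n. (\<delta> n)\<^sup>2 / 4) \<longlonglongrightarrow> 0" by (subst filterlim_sequentially_Suc[symmetric])
  from tendsto_diff[OF L this] have u2: "(\<lambda>n. (u n)\<^sup>2) \<longlonglongrightarrow> L" by (simp add: V_def)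
  then have "L \<ge> 0" by (rule LIMSEQ_le_const) simp
  have sum\<psi>: "summable (\<lambda>n. \<gamma> n * \<psi> (u (Suc n)))"
    by (rule summable_comparison_test'[OF sum\<beta>, of 0]) (use \<psi>(2) \<gamma>(1) in \<open>auto simp: \<beta>_def less_imp_le\<close>)
  have "L = 0"
  proof (rule ccontr)
    assume "L \<noteq> 0"
    then have "L > 0" using \<open>L \<ge> 0\<close> by simp
    \<comment> \<open>A level strictly below the limit of \<open>u\<close>. Continuity of
      \<open>\<psi>\<close> is not assumed, so monotonicity at this fixed level supplies the
      positive lower bound that contradicts divergence of the step sizes.\<close>
    define c where "c = sqrt (L / 2)"
    have c: "c > 0" "c\<^sup>2 = L / 2" using \<open>L > 0\<close> by (auto simp: c_def)
    have "L / 2 < L" using \<open>L > 0\<close> by simp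
    from order_tendstoD(1)[OF u2 this] obtain N where N: "\<And>n. n \<ge> N \<Longrightarrow> L / 2 < (u n)\<^sup>2"
      by (auto simp: eventually_sequentially)
    have "c \<le> u n" if "n \<ge> N" for n
      using N[OF that] c u0[of n] by (metis less_imp_le power2_le_imp_le)
    then have "\<psi> c \<le> \<psi> (u (Suc n))" if "n \<ge> N" for n using that monoD[OF \<psi>(1)] by (simp add: le_SucI)
    then have "summable (\<lambda>n. \<gamma> n * \<psi> c)"
      by (intro summable_comparison_test'[OF sum\<psi>, of N]) (use \<psi>(2) \<gamma>(1) in \<open>auto simp: abs_mult less_imp_le intro!: mult_left_mono\<close>)
    then have "summable \<gamma>" using \<psi>(3)[OF c(1)] summable_cmult_iff[of "\<psi> c" \<gamma>] by (simp add: mult.commute)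
    with \<gamma>(2) show False by simp
  qed
  with u2 have "(\<lambda>n. sqrt ((u n)\<^sup>2)) \<longlonglongrightarrow> sqrt 0" by (intro tendsto_real_sqrt) simp
  then show ?thesis using u0 by simp
qed

section \<open>Square-integrable martingales\<close>

lemma (in prob_space) sigma_finite_subalgebraI:
  "subalgebra M G \<Longrightarrow> sigma_finite_subalgebra M G"
  by (intro finite_measure_subalgebra_is_sigma_finite) unfold_locales

lemma subalgebra_filtration_mono:
  assumes "\<And>n. subalgebra (F (Suc n)) (F n)" "m \<le> n"
  shows "subalgebra (F n) (F m)"
  using assms(2)
proof (induction rule: dec_induct)
  case base
  then show ?case by (simp add: subalgebra_def)
next
  case (step n)
  then show ?case using assms(1)[of n] by (auto simp: subalgebra_def)
qed

text \<open>Orthogonality of increments: \<open>T * h n\<close> is known at time \<open>n\<close>,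
  so its product with \<open>d n\<close> has mean zero. Integrability is carried in the same
  induction because the cross term needs it. The predictable factors \<open>h\<close> make the
  identity applicable to stopped sums.\<close>

lemma (in prob_space) martingale_transform_L2:
  fixes h d :: "nat \<Rightarrow> 'a \<Rightarrow> real"
  assumes sub: "\<And>n. subalgebra M (F n)" and filt: "\<And>n. subalgebra (F (Suc n)) (F n)"
    and d: "\<And>n. d n \<in> borel_measurable (F (Suc n))"
    and sq: "\<And>n. integrable M (\<lambda>\<omega>. (d n \<omega>)\<^sup>2)"
    and ce: "\<And>n. AE \<omega> in M. real_cond_exp M (F n) (d n) \<omega> = 0"
    and h: "\<And>n. h n \<in> borel_measurable (F n)" and h1: "\<And>n \<omega>. \<bar>h n \<omega>\<bar> \<le> 1"
  shows "integrable M (\<lambda>\<omega>. (\<Sum>k<n. h k \<omega> * d k \<omega>)\<^sup>2) \<and>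
    expectation (\<lambda>\<omega>. (\<Sum>k<n. h k \<omega> * d k \<omega>)\<^sup>2) = (\<Sum>k<n. expectation (\<lambda>\<omega>. (h k \<omega> * d k \<omega>)\<^sup>2))"
proof (induction n)
  case (Suc n)
  define T where "T \<omega> = (\<Sum>k<n. h k \<omega> * d k \<omega>)" for \<omega>
  have dM: "d k \<in> borel_measurable M" and hM: "h k \<in> borel_measurable M" for k
    using measurable_from_subalg[OF sub] d h by blast+
  have T_F: "T \<in> borel_measurable (F n)" unfolding T_def
  proof (intro borel_measurable_sum borel_measurable_times)
    fix k assume "k \<in> {..<n}"
    then have "k \<le> n" "Suc k \<le> n" by auto
    then show "h k \<in> borel_measurable (F n)" "d k \<in> borel_measurable (F n)"
      using measurable_from_subalg[OF subalgebra_filtration_mono[of F, OF filt]] h d by blast+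
  qed
  have T_M: "T \<in> borel_measurable M" using measurable_from_subalg[OF sub T_F] .
  note [measurable] = T_M dM hM
  have T2: "integrable M (\<lambda>\<omega>. (T \<omega>)\<^sup>2)" using Suc unfolding T_def by blast
  have hd2: "integrable M (\<lambda>\<omega>. (h n \<omega> * d n \<omega>)\<^sup>2)"
  proof (rule Bochner_Integration.integrable_bound[OF sq[of n]])
    show "AE \<omega> in M. norm ((h n \<omega> * d n \<omega>)\<^sup>2) \<le> norm ((d n \<omega>)\<^sup>2)"
      using h1[of n] by (auto simp: power_mult_distrib abs_square_le_1 mult_left_le_one_le)
  qed measurable
  have cross: "integrable M (\<lambda>\<omega>. (T \<omega> * h n \<omega>) * d n \<omega>)"
  proof (rule Bochner_Integration.integrable_bound[OF Bochner_Integration.integrable_add[OF T2 hd2]])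
    have "\<bar>T \<omega> * h n \<omega> * d n \<omega>\<bar> \<le> (T \<omega>)\<^sup>2 + (h n \<omega> * d n \<omega>)\<^sup>2" for \<omega>
    proof -
      have "2 * (\<bar>T \<omega>\<bar> * \<bar>h n \<omega> * d n \<omega>\<bar>) \<le> (T \<omega>)\<^sup>2 + (h n \<omega> * d n \<omega>)\<^sup>2"
        using sum_squares_bound[of "\<bar>T \<omega>\<bar>" "\<bar>h n \<omega> * d n \<omega>\<bar>"] by (simp add: mult.assoc)
      moreover have "0 \<le> \<bar>T \<omega>\<bar> * \<bar>h n \<omega> * d n \<omega>\<bar>" by simp
      ultimately have "\<bar>T \<omega>\<bar> * \<bar>h n \<omega> * d n \<omega>\<bar> \<le> (T \<omega>)\<^sup>2 + (h n \<omega> * d n \<omega>)\<^sup>2" by linarith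
      then show ?thesis by (simp add: abs_mult mult.assoc)
    qed
    then show "AE \<omega> in M. norm (T \<omega> * h n \<omega> * d n \<omega>) \<le> norm ((T \<omega>)\<^sup>2 + (h n \<omega> * d n \<omega>)\<^sup>2)"
      by (auto simp: abs_of_nonneg)
  qed measurable
  interpret S: sigma_finite_subalgebra M "F n" using sigma_finite_subalgebraI[OF sub] .
  have "(\<lambda>\<omega>. T \<omega> * h n \<omega>) \<in> borel_measurable (F n)" using T_F h by (rule borel_measurable_times)
  from S.real_cond_exp_intg(2)[OF cross this dM]
  have "expectation (\<lambda>\<omega>. (T \<omega> * h n \<omega>) * d n \<omega>)
    = expectation (\<lambda>\<omega>. (T \<omega> * h n \<omega>) * real_cond_exp M (F n) (d n) \<omega>)" by simp
  also have "\<dots> = expectation (\<lambda>\<omega>. 0)"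
    using ce[of n] by (intro integral_cong_AE) (auto intro: measurable_from_subalg[OF sub])
  finally have cross0: "expectation (\<lambda>\<omega>. (T \<omega> * h n \<omega>) * d n \<omega>) = 0" by simp
  have eq: "(\<Sum>k<Suc n. h k \<omega> * d k \<omega>)\<^sup>2 = ((T \<omega>)\<^sup>2 + 2 * ((T \<omega> * h n \<omega>) * d n \<omega>)) + (h n \<omega> * d n \<omega>)\<^sup>2" for \<omega>
    by (simp add: T_def power2_sum algebra_simps)
  have c2: "integrable M (\<lambda>\<omega>. 2 * ((T \<omega> * h n \<omega>) * d n \<omega>))" using cross by simp
  have "expectation (\<lambda>\<omega>. ((T \<omega>)\<^sup>2 + 2 * ((T \<omega> * h n \<omega>) * d n \<omega>)) + (h n \<omega> * d n \<omega>)\<^sup>2)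
    = expectation (\<lambda>\<omega>. (T \<omega>)\<^sup>2) + expectation (\<lambda>\<omega>. 2 * ((T \<omega> * h n \<omega>) * d n \<omega>)) + expectation (\<lambda>\<omega>. (h n \<omega> * d n \<omega>)\<^sup>2)"
    using T2 hd2 c2 by simp
  then show ?case unfolding eq
    using T2 hd2 c2 cross0 Suc by (auto simp: T_def[symmetric])
qed simp

text \<open>Chebyshev's inequality is applied to the stopped sum: on the event its final value is
  the value at first passage, and stopping can only lower the variance.\<close>

lemma (in prob_space) martingale_maximal_inequality:
  fixes d :: "nat \<Rightarrow> 'a \<Rightarrow> real"
  assumes sub: "\<And>n. subalgebra M (F n)" and filt: "\<And>n. subalgebra (F (Suc n)) (F n)"
    and d: "\<And>n. d n \<in> borel_measurable (F (Suc n))"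
    and sq: "\<And>n. integrable M (\<lambda>\<omega>. (d n \<omega>)\<^sup>2)"
    and ce: "\<And>n. AE \<omega> in M. real_cond_exp M (F n) (d n) \<omega> = 0"
    and "0 < \<epsilon>" "m \<le> N"
  shows "prob {\<omega> \<in> space M. \<exists>n\<in>{m..N}. \<epsilon> \<le> \<bar>\<Sum>k=m..<n. d k \<omega>\<bar>}
    \<le> (\<Sum>k=m..<N. expectation (\<lambda>\<omega>. (d k \<omega>)\<^sup>2)) / \<epsilon>\<^sup>2"
proof -
  define S where "S n \<omega> = (\<Sum>k=m..<n. d k \<omega>)" for n \<omega>
  have S_F: "S j \<in> borel_measurable (F n)" if "j \<le> n" for j n
    unfolding S_def
  proof (rule borel_measurable_sum)
    fix k assume "k \<in> {m..<j}"
    then have "Suc k \<le> n" using that by auto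
    then show "d k \<in> borel_measurable (F n)"
      using measurable_from_subalg[OF subalgebra_filtration_mono[of F, OF filt]] d by blast
  qed
  \<comment> \<open>The transform by \<open>h\<close> is the martingale stopped when \<open>S\<close> first reaches level \<open>\<epsilon>\<close>.\<close>
  define h where "h k \<omega> = (if m \<le> k \<and> (\<forall>j\<in>{m..k}. \<bar>S j \<omega>\<bar> < \<epsilon>) then 1 else 0 :: real)" for k \<omega>
  have h_F: "h k \<in> borel_measurable (F k)" for k
  proof -
    have [measurable]: "S j \<in> borel_measurable (F k)" if "j \<in> {m..k}" for j
      using S_F[of j k] that by simp
    show ?thesis unfolding h_def by measurable
  qed
  have h1: "\<bar>h k \<omega>\<bar> \<le> 1" for k \<omega> by (simp add: h_def)
  define T where "T \<omega> = (\<Sum>k<N. h k \<omega> * d k \<omega>)" for \<omega>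
  have T2: "integrable M (\<lambda>\<omega>. (T \<omega>)\<^sup>2)"
    and ET: "expectation (\<lambda>\<omega>. (T \<omega>)\<^sup>2) = (\<Sum>k<N. expectation (\<lambda>\<omega>. (h k \<omega> * d k \<omega>)\<^sup>2))"
    using martingale_transform_L2[of F d h N, OF sub filt d sq ce h_F h1] unfolding T_def by auto
  have dM [measurable]: "d k \<in> borel_measurable M" and hM [measurable]: "h k \<in> borel_measurable M" for k
    using measurable_from_subalg[OF sub] d h_F by blast+
  have [measurable]: "T \<in> borel_measurable M" unfolding T_def by measurable
  have le: "expectation (\<lambda>\<omega>. (h k \<omega> * d k \<omega>)\<^sup>2) \<le> (if m \<le> k then expectation (\<lambda>\<omega>. (d k \<omega>)\<^sup>2) else 0)" for k
  proof (cases "m \<le> k")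
    case True
    have "expectation (\<lambda>\<omega>. (h k \<omega> * d k \<omega>)\<^sup>2) \<le> expectation (\<lambda>\<omega>. (d k \<omega>)\<^sup>2)"
      by (rule integral_mono_AE') (auto simp: sq h_def)
    then show ?thesis using True by simp
  qed (simp add: h_def)
  have "expectation (\<lambda>\<omega>. (T \<omega>)\<^sup>2) \<le> (\<Sum>k<N. if m \<le> k then expectation (\<lambda>\<omega>. (d k \<omega>)\<^sup>2) else 0)"
    unfolding ET by (rule sum_mono) (rule le)
  also have "\<dots> = (\<Sum>k=m..<N. expectation (\<lambda>\<omega>. (d k \<omega>)\<^sup>2))"
    by (rule sum.mono_neutral_cong_right) auto
  finally have ET': "expectation (\<lambda>\<omega>. (T \<omega>)\<^sup>2) \<le> (\<Sum>k=m..<N. expectation (\<lambda>\<omega>. (d k \<omega>)\<^sup>2))" .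
  have sub: "{\<omega> \<in> space M. \<exists>n\<in>{m..N}. \<epsilon> \<le> \<bar>S n \<omega>\<bar>} \<subseteq> {\<omega> \<in> space M. \<epsilon>\<^sup>2 \<le> (T \<omega>)\<^sup>2}"
  proof clarify
    fix \<omega> n assume \<omega>: "\<omega> \<in> space M" and n: "n \<in> {m..N}" "\<epsilon> \<le> \<bar>S n \<omega>\<bar>"
    define n0 where "n0 = (LEAST n. m \<le> n \<and> \<epsilon> \<le> \<bar>S n \<omega>\<bar>)"
    have n0: "m \<le> n0" "\<epsilon> \<le> \<bar>S n0 \<omega>\<bar>" and "n0 \<le> n"
      using LeastI[of "\<lambda>n. m \<le> n \<and> \<epsilon> \<le> \<bar>S n \<omega>\<bar>" n] Least_le[of "\<lambda>n. m \<le> n \<and> \<epsilon> \<le> \<bar>S n \<omega>\<bar>" n] n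
      by (auto simp: n0_def)
    have before: "\<bar>S j \<omega>\<bar> < \<epsilon>" if "m \<le> j" "j < n0" for j
      using not_less_Least[of j "\<lambda>n. m \<le> n \<and> \<epsilon> \<le> \<bar>S n \<omega>\<bar>"] that by (auto simp: n0_def)
    \<comment> \<open>Since \<open>S j\<close> involves \<open>d\<close> only below
      \<open>j\<close>, testing \<open>j\<close> up to \<open>k\<close> keeps \<open>h k\<close>
      predictable and yet retains the increment \<open>d (n0 - 1)\<close> that causes the passage.
      The retained increments thus add up to \<open>S n0\<close>.\<close>
    have "h k \<omega> = (if m \<le> k \<and> k < n0 then 1 else 0)" for k
      using before n0 by (force simp: h_def)
    then have "T \<omega> = (\<Sum>k<N. if m \<le> k \<and> k < n0 then d k \<omega> else 0)"
      unfolding T_def by (intro sum.cong) auto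
    also have "\<dots> = S n0 \<omega>"
      unfolding S_def using \<open>n0 \<le> n\<close> n(1) by (intro sum.mono_neutral_cong_right) auto
    finally have "\<epsilon> \<le> \<bar>T \<omega>\<bar>" using n0(2) by simp
    then have "\<epsilon>\<^sup>2 \<le> \<bar>T \<omega>\<bar>\<^sup>2" using \<open>0 < \<epsilon>\<close> by (intro power_mono) auto
    then show "\<epsilon>\<^sup>2 \<le> (T \<omega>)\<^sup>2" by simp
  qed
  have "prob {\<omega> \<in> space M. \<exists>n\<in>{m..N}. \<epsilon> \<le> \<bar>S n \<omega>\<bar>} \<le> prob {\<omega> \<in> space M. \<epsilon>\<^sup>2 \<le> (T \<omega>)\<^sup>2}"
    by (rule finite_measure_mono[OF sub]) measurable
  also have "\<dots> \<le> expectation (\<lambda>\<omega>. (T \<omega>)\<^sup>2) / \<epsilon>\<^sup>2"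
    by (rule integral_Markov_inequality_measure[where A = "{}"]) (use \<open>0 < \<epsilon>\<close> T2 in auto)
  also have "\<dots> \<le> (\<Sum>k=m..<N. expectation (\<lambda>\<omega>. (d k \<omega>)\<^sup>2)) / \<epsilon>\<^sup>2"
    by (rule divide_right_mono[OF ET']) simp
  finally show ?thesis unfolding S_def .
qed

text \<open>\<open>E \<epsilon> m N\<close> is the event of leaving the
  \<open>\<epsilon>\<close>-ball around the partial sum at \<open>m\<close> by time
  \<open>N\<close>. Its bound, a tail of the variance series, does not depend on \<open>N\<close>
  and vanishes as \<open>m\<close> grows. Countably many levels \<open>\<epsilon>\<close> then give
  the Cauchy property almost surely.\<close>

lemma (in prob_space) L2_martingale_convergence:
  fixes d :: "nat \<Rightarrow> 'a \<Rightarrow> real"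
  assumes sub: "\<And>n. subalgebra M (F n)" and filt: "\<And>n. subalgebra (F (Suc n)) (F n)"
    and d: "\<And>n. d n \<in> borel_measurable (F (Suc n))"
    and sq: "\<And>n. integrable M (\<lambda>\<omega>. (d n \<omega>)\<^sup>2)"
    and ce: "\<And>n. AE \<omega> in M. real_cond_exp M (F n) (d n) \<omega> = 0"
    and summ: "summable (\<lambda>n. expectation (\<lambda>\<omega>. (d n \<omega>)\<^sup>2))"
  shows "AE \<omega> in M. summable (\<lambda>n. d n \<omega>)"
proof -
  define v where "v n = expectation (\<lambda>\<omega>. (d n \<omega>)\<^sup>2)" for n
  have sv: "summable v" using summ by (simp add: v_def[abs_def])
  have v0: "0 \<le> v n" for n by (simp add: v_def)
  have dM [measurable]: "d k \<in> borel_measurable M" for k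
    using measurable_from_subalg[OF sub d] .
  define E where "E \<epsilon> m N = {\<omega> \<in> space M. \<exists>n\<in>{m..N}. \<epsilon> \<le> \<bar>\<Sum>k=m..<n. d k \<omega>\<bar>}" for \<epsilon> :: real and m N :: nat
  have E_sets [measurable]: "E \<epsilon> m N \<in> sets M" for \<epsilon> m N unfolding E_def by measurable
  have E_le: "prob (E \<epsilon> m N) \<le> (suminf v - sum v {..<m}) / \<epsilon>\<^sup>2" if "\<epsilon> > 0" for \<epsilon> m N
  proof (cases "m \<le> N")
    case True
    have "prob (E \<epsilon> m N) \<le> (\<Sum>k=m..<N. v k) / \<epsilon>\<^sup>2"
      using martingale_maximal_inequality[of F d, OF sub filt d sq ce that True] unfolding E_def v_def .
    also have "(\<Sum>k=m..<N. v k) = sum v {..<N} - sum v {..<m}"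
      using True by (simp add: sum_diff_nat_ivl[of 0 m N v, symmetric] atLeast0LessThan)
    also have "\<dots> / \<epsilon>\<^sup>2 \<le> (suminf v - sum v {..<m}) / \<epsilon>\<^sup>2"
      using sum_le_suminf[of v "{..<N}"] sv v0 by (intro divide_right_mono) auto
    finally show ?thesis .
  next
    case False
    then show ?thesis
      using sum_le_suminf[of v "{..<m}"] sv v0 by (auto simp: E_def)
  qed
  have "AE \<omega> in M. \<exists>m. \<forall>N. \<omega> \<notin> E \<epsilon> m N" if "\<epsilon> > 0" for \<epsilon>
  proof -
    define bad where "bad = (\<Inter>m. \<Union>N. E \<epsilon> m N)"
    have [measurable]: "bad \<in> sets M" unfolding bad_def by measurable
    have "prob bad \<le> (suminf v - sum v {..<m}) / \<epsilon>\<^sup>2" for m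
    proof -
      have "prob bad \<le> prob (\<Union>N. E \<epsilon> m N)"
        by (rule finite_measure_mono) (auto simp: bad_def)
      also have "\<dots> \<le> (suminf v - sum v {..<m}) / \<epsilon>\<^sup>2"
      proof (rule LIMSEQ_le_const2[OF finite_Lim_measure_incseq])
        show "incseq (E \<epsilon> m)" by (force simp: incseq_def E_def)
      qed (use E_le[OF that] in auto)
      finally show ?thesis .
    qed
    moreover have "(\<lambda>m. (suminf v - sum v {..<m}) / \<epsilon>\<^sup>2) \<longlonglongrightarrow> (suminf v - suminf v) / \<epsilon>\<^sup>2"
      using sv by (intro tendsto_intros summable_LIMSEQ) (use that in auto)
    ultimately have "prob bad \<le> 0"
      by (intro LIMSEQ_le_const) auto
    then have "prob bad = 0" by (simp add: measure_le_0_iff)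
    then have "AE \<omega> in M. \<omega> \<notin> bad" by (simp add: prob_eq_0)
    then show ?thesis by (simp add: bad_def)
  qed
  then have "AE \<omega> in M. \<forall>i. \<exists>m. \<forall>N. \<omega> \<notin> E (inverse (real (Suc i))) m N"
    unfolding AE_all_countable by (metis inverse_positive_iff_positive of_nat_0_less_iff zero_less_Suc)
  then show ?thesis
    using AE_space
  proof eventually_elim
    case (elim \<omega>)
    show ?case
      unfolding summable_iff_convergent
    proof (rule Cauchy_convergent, rule metric_CauchyI)
      fix e :: real assume "e > 0"
      then obtain i where i: "inverse (real (Suc i)) < e / 2" using reals_Archimedean[of "e / 2"] by auto
      obtain m where m: "\<And>N. \<omega> \<notin> E (inverse (real (Suc i))) m N" using elim(1) by blast
      have *: "\<bar>(\<Sum>k<n. d k \<omega>) - (\<Sum>k<m. d k \<omega>)\<bar> < e / 2" if "n \<ge> m" for n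
      proof -
        have "\<bar>\<Sum>k=m..<n. d k \<omega>\<bar> < inverse (real (Suc i))"
          using m[of n] that elim(2) by (auto simp: E_def not_le)
        moreover have "(\<Sum>k=m..<n. d k \<omega>) = (\<Sum>k<n. d k \<omega>) - (\<Sum>k<m. d k \<omega>)"
          using that by (simp add: sum_diff_nat_ivl[of 0 m n, symmetric] atLeast0LessThan)
        ultimately show ?thesis using i by simp
      qed
      show "\<exists>m. \<forall>n\<ge>m. \<forall>n'\<ge>m. dist (\<Sum>k<n. d k \<omega>) (\<Sum>k<n'. d k \<omega>) < e"
      proof (intro exI allI impI)
        fix n n' assume "m \<le> n" "m \<le> n'"
        from *[OF this(1)] *[OF this(2)] show "dist (\<Sum>k<n. d k \<omega>) (\<Sum>k<n'. d k \<omega>) < e"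
          unfolding dist_real_def by linarith
      qed
    qed
  qed
qed

section \<open>Conditionally centred noise\<close>

text \<open>Centredness of the vector \<open>e\<close> is given through integrals over sets of
  \<open>G\<close>. For simple \<open>u\<close> the inner product splits over level sets, which lie
  in \<open>G\<close>; bounded \<open>u\<close> follows by dominated convergence.\<close>

lemma (in prob_space)
  fixes e u :: "'a \<Rightarrow> 'b::{real_inner, banach, second_countable_topology}"
  assumes G: "subalgebra M G" and e: "integrable M e"
    and e0: "\<And>S. S \<in> sets G \<Longrightarrow> (LINT \<omega>:S|M. e \<omega>) = 0"
    and u: "u \<in> borel_measurable G" and C: "\<And>\<omega>. \<omega> \<in> space M \<Longrightarrow> norm (u \<omega>) \<le> C"
  shows integrable_inner_bounded: "integrable M (\<lambda>\<omega>. inner (u \<omega>) (e \<omega>))"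
    and cond_exp_inner_eq_0: "AE \<omega> in M. real_cond_exp M G (\<lambda>\<omega>. inner (u \<omega>) (e \<omega>)) \<omega> = 0"
proof -
  have sp: "space G = space M" using G by (simp add: subalgebra_def)
  have [measurable]: "e \<in> borel_measurable M" using e by (rule borel_measurable_integrable)
  have int: "integrable M (\<lambda>\<omega>. inner (v \<omega>) (e \<omega>))"
    if v: "v \<in> borel_measurable G" and C': "\<And>\<omega>. \<omega> \<in> space M \<Longrightarrow> norm (v \<omega>) \<le> C'" for v C'
  proof (rule Bochner_Integration.integrable_bound[OF integrable_mult_right[OF integrable_norm[OF e], of C']])
    have [measurable]: "v \<in> borel_measurable M" using measurable_from_subalg[OF G v] .
    show "(\<lambda>\<omega>. inner (v \<omega>) (e \<omega>)) \<in> borel_measurable M" by measurable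
    show "AE \<omega> in M. norm (inner (v \<omega>) (e \<omega>)) \<le> norm (C' * norm (e \<omega>))"
    proof (rule AE_I2)
      fix \<omega> assume "\<omega> \<in> space M"
      have "\<bar>inner (v \<omega>) (e \<omega>)\<bar> \<le> norm (v \<omega>) * norm (e \<omega>)" by (rule Cauchy_Schwarz_ineq2)
      also have "\<dots> \<le> C' * norm (e \<omega>)" using C'[OF \<open>\<omega> \<in> space M\<close>] by (rule mult_right_mono) simp
      finally show "norm (inner (v \<omega>) (e \<omega>)) \<le> norm (C' * norm (e \<omega>))" by simp
    qed
  qed
  have zero: "(\<integral>\<omega>. inner (v \<omega>) (e \<omega>) \<partial>M) = 0"
    if v: "v \<in> borel_measurable G" and C': "\<And>\<omega>. \<omega> \<in> space M \<Longrightarrow> norm (v \<omega>) \<le> C'" for v C'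
  proof -
    \<comment> \<open>Approximation relative to the base point 0 gives
      \<open>norm (s i \<omega>) \<le> 2 * norm (v \<omega>)\<close>, the source of the factor 2 in
      the dominating function.\<close>
    obtain s where s: "\<And>i. simple_function G (s i)"
      and s_lim: "\<And>\<omega>. \<omega> \<in> space G \<Longrightarrow> (\<lambda>i. s i \<omega>) \<longlonglongrightarrow> v \<omega>"
      and s_le: "\<And>i \<omega>. \<omega> \<in> space G \<Longrightarrow> norm (s i \<omega>) \<le> 2 * norm (v \<omega>)"
      using borel_measurable_implies_sequence_metric[OF v, of 0] unfolding dist_norm diff_zero by metis
    have sG: "s i \<in> borel_measurable G" for i using s by (rule borel_measurable_simple_function)
    have sM [measurable]: "s i \<in> borel_measurable M" for i using measurable_from_subalg[OF G sG] .
    have vM [measurable]: "v \<in> borel_measurable M" using measurable_from_subalg[OF G v] .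
    have "(\<integral>\<omega>. inner (s i \<omega>) (e \<omega>) \<partial>M) = 0" for i
    proof -
      define Y where "Y = s i ` space M"
      have fin: "finite Y" using simple_functionD(1)[OF s[of i]] by (simp add: Y_def sp)
      define P where "P y = s i -` {y} \<inter> space M" for y
      have P: "P y \<in> sets G" for y using simple_functionD(2)[OF s[of i]] by (simp add: P_def sp[symmetric])
      have PM: "P y \<in> sets M" for y using P[of y] G by (auto simp: subalgebra_def)
      have Pe: "integrable M (\<lambda>\<omega>. indicator (P y) \<omega> *\<^sub>R e \<omega>)" for y
        using integrable_mult_indicator[OF PM e] .
      have "(\<integral>\<omega>. inner (s i \<omega>) (e \<omega>) \<partial>M) = (\<integral>\<omega>. (\<Sum>y\<in>Y. inner y (indicator (P y) \<omega> *\<^sub>R e \<omega>)) \<partial>M)"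
      proof (rule Bochner_Integration.integral_cong[OF refl])
        fix \<omega> assume \<omega>: "\<omega> \<in> space M"
        have "(\<Sum>y\<in>Y. inner y (indicator (P y) \<omega> *\<^sub>R e \<omega>)) = (\<Sum>y\<in>Y. if y = s i \<omega> then inner y (e \<omega>) else 0)"
          using \<omega> by (intro sum.cong) (auto simp: P_def indicator_def)
        also have "\<dots> = inner (s i \<omega>) (e \<omega>)" using fin \<omega> by (simp add: Y_def)
        finally show "inner (s i \<omega>) (e \<omega>) = (\<Sum>y\<in>Y. inner y (indicator (P y) \<omega> *\<^sub>R e \<omega>))" by simp
      qed
      also have "\<dots> = (\<Sum>y\<in>Y. \<integral>\<omega>. inner y (indicator (P y) \<omega> *\<^sub>R e \<omega>) \<partial>M)"
        by (rule Bochner_Integration.integral_sum) (rule integrable_inner_right[OF Pe])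
      also have "\<dots> = (\<Sum>y\<in>Y. inner y (\<integral>\<omega>. indicator (P y) \<omega> *\<^sub>R e \<omega> \<partial>M))"
        by (intro sum.cong refl integral_inner_right Pe)
      also have "\<dots> = 0" using e0[OF P] by (simp add: set_lebesgue_integral_def)
      finally show ?thesis .
    qed
    moreover have "(\<lambda>i. \<integral>\<omega>. inner (s i \<omega>) (e \<omega>) \<partial>M) \<longlonglongrightarrow> (\<integral>\<omega>. inner (v \<omega>) (e \<omega>) \<partial>M)"
    proof (rule integral_dominated_convergence[where w = "\<lambda>\<omega>. (2 * C') * norm (e \<omega>)"])
      show "integrable M (\<lambda>\<omega>. (2 * C') * norm (e \<omega>))" using e by simp
      show "AE \<omega> in M. (\<lambda>i. inner (s i \<omega>) (e \<omega>)) \<longlonglongrightarrow> inner (v \<omega>) (e \<omega>)"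
        using s_lim sp by (auto intro!: AE_I2 tendsto_inner)
      fix i
      show "AE \<omega> in M. norm (inner (s i \<omega>) (e \<omega>)) \<le> (2 * C') * norm (e \<omega>)"
      proof (rule AE_I2)
        fix \<omega> assume \<omega>: "\<omega> \<in> space M"
        have "\<bar>inner (s i \<omega>) (e \<omega>)\<bar> \<le> norm (s i \<omega>) * norm (e \<omega>)" by (rule Cauchy_Schwarz_ineq2)
        also have "\<dots> \<le> (2 * C') * norm (e \<omega>)"
          using s_le[of \<omega> i] C'[OF \<omega>] \<omega> sp by (intro mult_right_mono) auto
        finally show "norm (inner (s i \<omega>) (e \<omega>)) \<le> (2 * C') * norm (e \<omega>)" by simp
      qed
    qed measurable
    ultimately show ?thesis by (simp add: LIMSEQ_const_iff)
  qed
  show I: "integrable M (\<lambda>\<omega>. inner (u \<omega>) (e \<omega>))" by (rule int[OF u C])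
  interpret S: sigma_finite_subalgebra M G using sigma_finite_subalgebraI[OF G] .
  show "AE \<omega> in M. real_cond_exp M G (\<lambda>\<omega>. inner (u \<omega>) (e \<omega>)) \<omega> = 0"
  proof (rule S.real_cond_exp_charact)
    fix S assume S: "S \<in> sets G"
    \<comment> \<open>Cutting \<open>u\<close> off outside \<open>S\<close> keeps it bounded and
      \<open>G\<close>-measurable, so \<open>zero\<close> supplies every set integral that
      characterises the conditional expectation.\<close>
    have m: "(\<lambda>\<omega>. indicator S \<omega> *\<^sub>R u \<omega>) \<in> borel_measurable G" using S u by measurable
    have b: "norm (indicator S \<omega> *\<^sub>R u \<omega>) \<le> C" if "\<omega> \<in> space M" for \<omega>
      using C[OF that] order_trans[OF norm_ge_zero C[OF that]] by (simp add: indicator_def)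
    have "(LINT \<omega>:S|M. inner (u \<omega>) (e \<omega>)) = (\<integral>\<omega>. inner (indicator S \<omega> *\<^sub>R u \<omega>) (e \<omega>) \<partial>M)"
      by (simp add: set_lebesgue_integral_def)
    also have "\<dots> = 0" by (rule zero[OF m b])
    finally show "(LINT \<omega>:S|M. inner (u \<omega>) (e \<omega>)) = (LINT \<omega>:S|M. 0)"
      by (simp add: set_lebesgue_integral_def)
  qed (use I in auto)
qed

text \<open>The test includes the current term, so the stopped sum never overshoots
  \<open>K\<close>. For a predictable compensator \<open>c\<close> this test is still known at time
  \<open>n\<close>.\<close>

lemma sum_stopped_le:
  fixes c :: "nat \<Rightarrow> ennreal"
  shows "(\<Sum>n<N. if (\<Sum>k\<le>n. c k) \<le> K then c n else 0) \<le> K"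
proof (induction N)
  case (Suc N)
  show ?case
  proof (cases "(\<Sum>k\<le>N. c k) \<le> K")
    case True
    have "(\<Sum>n<Suc N. if (\<Sum>k\<le>n. c k) \<le> K then c n else 0) \<le> (\<Sum>n<Suc N. c n)"
      by (intro sum_mono) auto
    with True show ?thesis by (simp add: lessThan_Suc_atMost)
  next
    case False
    then show ?thesis using Suc by simp
  qed
qed simp

lemma (in prob_space) cond_exp_power2_le:
  assumes G: "subalgebra M G" and X: "integrable M X" "integrable M (\<lambda>\<omega>. (X \<omega>)\<^sup>2)"
  shows "integrable M (\<lambda>\<omega>. (real_cond_exp M G X \<omega>)\<^sup>2)"
    and "expectation (\<lambda>\<omega>. (real_cond_exp M G X \<omega>)\<^sup>2) \<le> expectation (\<lambda>\<omega>. (X \<omega>)\<^sup>2)"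
proof -
  interpret S: sigma_finite_subalgebra M G using sigma_finite_subalgebraI[OF G] .
  have J: "AE \<omega> in M. (real_cond_exp M G X \<omega>)\<^sup>2 \<le> real_cond_exp M G (\<lambda>\<omega>. (X \<omega>)\<^sup>2) \<omega>"
    by (rule S.real_cond_exp_jensens_inequality(2)[where I = UNIV and q = "\<lambda>x. x\<^sup>2"])
       (use X convex_power2 in auto)
  have R: "integrable M (real_cond_exp M G (\<lambda>\<omega>. (X \<omega>)\<^sup>2))"
    "expectation (real_cond_exp M G (\<lambda>\<omega>. (X \<omega>)\<^sup>2)) = expectation (\<lambda>\<omega>. (X \<omega>)\<^sup>2)"
    using S.real_cond_exp_int[OF X(2)] by auto
  show *: "integrable M (\<lambda>\<omega>. (real_cond_exp M G X \<omega>)\<^sup>2)"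
    by (rule Bochner_Integration.integrable_bound[OF R(1)]) (use J in auto)
  show "expectation (\<lambda>\<omega>. (real_cond_exp M G X \<omega>)\<^sup>2) \<le> expectation (\<lambda>\<omega>. (X \<omega>)\<^sup>2)"
    using integral_mono_AE[OF * R(1) J] R(2) by simp
qed

text \<open>Neither \<open>e n\<close> nor \<open>inner (u n) (e n)\<close> need be measurable with respect to \<open>F (Suc n)\<close>, so the partial
  sums of the noise are not a martingale. Their projections onto \<open>F (Suc n)\<close> are martingale
  differences and still dominate the adapted process \<open>\<zeta>\<close>.\<close>
lemma (in prob_space) AE_summable_dominating_noise:
  fixes e u :: "nat \<Rightarrow> 'a \<Rightarrow> 'b::{real_inner, banach, second_countable_topology}"
    and \<zeta> :: "nat \<Rightarrow> 'a \<Rightarrow> real" and g :: "nat \<Rightarrow> real"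
  assumes sub: "\<And>n. subalgebra M (F n)" and filt: "\<And>n. subalgebra (F (Suc n)) (F n)"
    and e: "\<And>n. integrable M (e n)"
    and e0: "\<And>n S. S \<in> sets (F n) \<Longrightarrow> (LINT \<omega>:S|M. e n \<omega>) = 0"
    and u: "\<And>n. u n \<in> borel_measurable (F n)"
    and D: "\<And>n \<omega>. \<omega> \<in> space M \<Longrightarrow> norm (u n \<omega>) \<le> D"
    and noise: "AE \<omega> in M. (\<Sum>n. ennreal ((g n)\<^sup>2) *
      nn_cond_exp M (F n) (\<lambda>\<omega>'. ennreal ((norm (e n \<omega>'))\<^sup>2)) \<omega>) < \<infinity>"
    and \<zeta>: "\<And>n. \<zeta> n \<in> borel_measurable (F (Suc n))" "\<And>n. integrable M (\<zeta> n)"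
    and \<zeta>_le: "\<And>n. AE \<omega> in M. \<zeta> n \<omega> \<le> a * (g n)\<^sup>2 * (norm (e n \<omega>))\<^sup>2 - b * g n * inner (u n \<omega>) (e n \<omega>)"
  shows "AE \<omega> in M. \<exists>s. summable s \<and> (\<forall>n. \<zeta> n \<omega> \<le> s n)"
proof -
  define w where "w n = nn_cond_exp M (F n) (\<lambda>\<omega>'. ennreal ((norm (e n \<omega>'))\<^sup>2))" for n
  define c where "c n \<omega> = ennreal ((g n)\<^sup>2) * w n \<omega>" for n \<omega>
  have eM [measurable]: "e n \<in> borel_measurable M" for n using e by (rule borel_measurable_integrable)
  have w_F: "w n \<in> borel_measurable (F n)" for n unfolding w_def by (rule borel_measurable_nn_cond_exp)
  have T_F: "(\<lambda>\<omega>. \<Sum>k\<le>n. c k \<omega>) \<in> borel_measurable (F n)" for n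
    unfolding c_def
  proof (intro borel_measurable_sum borel_measurable_times_ennreal)
    fix k assume "k \<in> {..n}"
    then show "w k \<in> borel_measurable (F n)"
      using measurable_from_subalg[OF subalgebra_filtration_mono[of F, OF filt] w_F] by simp
  qed simp
  \<comment> \<open>On these paths stopping at level \<open>K\<close> changes nothing. By
    \<open>noise\<close> almost every path has a finite total and so falls under some natural
    \<open>K\<close>, and countably many null sets may be discarded.\<close>
  have local: "AE \<omega> in M. (\<forall>n. (\<Sum>k\<le>n. c k \<omega>) \<le> of_nat K) \<longrightarrow> (\<exists>s. summable s \<and> (\<forall>n. \<zeta> n \<omega> \<le> s n))" for K
  proof -
    \<comment> \<open>Stopping once the predictable compensator exceeds K makes the noise square integrable.\<close>
    define \<tau> where "\<tau> n \<omega> = (if (\<Sum>k\<le>n. c k \<omega>) \<le> of_nat K then 1 else 0 :: real)" for n \<omega>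
    have \<tau>01: "\<tau> n \<omega> = 0 \<or> \<tau> n \<omega> = 1" for n \<omega> by (simp add: \<tau>_def)
    have \<tau>_F: "\<tau> n \<in> borel_measurable (F n)" for n
      unfolding \<tau>_def using T_F[of n] by measurable
    have \<tau>_M [measurable]: "\<tau> n \<in> borel_measurable M" for n using measurable_from_subalg[OF sub \<tau>_F] .
    have \<tau>_F': "\<tau> n \<in> borel_measurable (F (Suc n))" for n using measurable_from_subalg[OF filt \<tau>_F] .
    define Q where "Q n \<omega> = \<tau> n \<omega> * (g n)\<^sup>2 * (norm (e n \<omega>))\<^sup>2" for n \<omega>
    have Q0: "0 \<le> Q n \<omega>" for n \<omega> using \<tau>01[of n \<omega>] by (auto simp: Q_def)
    have Q_M [measurable]: "Q n \<in> borel_measurable M" for n unfolding Q_def by measurable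
    \<comment> \<open>The stopping factor is known at time \<open>n\<close> and can be pulled
      through the conditional expectation. Working with extended nonnegative integrals presupposes
      no integrability of the squared noise.\<close>
    have QN: "(\<integral>\<^sup>+\<omega>. ennreal (Q n \<omega>) \<partial>M) = (\<integral>\<^sup>+\<omega>. (if (\<Sum>k\<le>n. c k \<omega>) \<le> of_nat K then c n \<omega> else 0) \<partial>M)" for n
    proof -
      interpret S: sigma_finite_subalgebra M "F n" using sigma_finite_subalgebraI[OF sub] .
      have m: "(\<lambda>\<omega>. ennreal (\<tau> n \<omega> * (g n)\<^sup>2)) \<in> borel_measurable (F n)" using \<tau>_F[of n] by measurable
      have "(\<integral>\<^sup>+\<omega>. ennreal (Q n \<omega>) \<partial>M) = (\<integral>\<^sup>+\<omega>. ennreal (\<tau> n \<omega> * (g n)\<^sup>2) * ennreal ((norm (e n \<omega>))\<^sup>2) \<partial>M)"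
        by (intro nn_integral_cong) (use \<tau>01 in \<open>auto simp: Q_def ennreal_mult'' [symmetric]\<close>)
      also have "\<dots> = (\<integral>\<^sup>+\<omega>. ennreal (\<tau> n \<omega> * (g n)\<^sup>2) * w n \<omega> \<partial>M)"
        unfolding w_def by (rule S.nn_cond_exp_intg[OF m, symmetric]) measurable
      also have "\<dots> = (\<integral>\<^sup>+\<omega>. (if (\<Sum>k\<le>n. c k \<omega>) \<le> of_nat K then c n \<omega> else 0) \<partial>M)"
        by (intro nn_integral_cong) (auto simp: \<tau>_def c_def)
      finally show ?thesis .
    qed
    have c_M [measurable]: "c n \<in> borel_measurable M" for n
      unfolding c_def using measurable_from_subalg[OF sub w_F[of n]] by measurable
    have "(\<Sum>n. \<integral>\<^sup>+\<omega>. ennreal (Q n \<omega>) \<partial>M)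
      = (\<integral>\<^sup>+\<omega>. (\<Sum>n. if (\<Sum>k\<le>n. c k \<omega>) \<le> of_nat K then c n \<omega> else 0) \<partial>M)"
      unfolding QN by (rule nn_integral_suminf[symmetric]) measurable
    also have "\<dots> \<le> (\<integral>\<^sup>+\<omega>. of_nat K \<partial>M)"
      by (intro nn_integral_mono suminf_le_const summableI sum_stopped_le)
    also have "\<dots> < \<infinity>" by (simp add: emeasure_space_1 of_nat_less_top)
    finally have Q_sum: "(\<Sum>n. \<integral>\<^sup>+\<omega>. ennreal (Q n \<omega>) \<partial>M) < \<infinity>" .
    have "(\<integral>\<^sup>+\<omega>. ennreal (Q n \<omega>) \<partial>M) < \<infinity>" for n
    proof -
      have "(\<integral>\<^sup>+\<omega>. ennreal (Q n \<omega>) \<partial>M) \<le> (\<Sum>n. \<integral>\<^sup>+\<omega>. ennreal (Q n \<omega>) \<partial>M)"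
        using sum_le_suminf[of "\<lambda>n. \<integral>\<^sup>+\<omega>. ennreal (Q n \<omega>) \<partial>M" "{n}"] by simp
      then show ?thesis using Q_sum by (rule le_less_trans)
    qed
    then have Q_int: "integrable M (Q n)" for n
      by (intro integrableI_nonneg) (use Q0 in auto)
    have Q_eq: "(\<integral>\<^sup>+\<omega>. ennreal (Q n \<omega>) \<partial>M) = ennreal (expectation (Q n))" for n
      by (intro nn_integral_eq_integral Q_int) (use Q0 in auto)
    have EQ0: "0 \<le> expectation (Q n)" for n by (intro integral_nonneg_AE) (use Q0 in auto)
    have EQ_sum: "summable (\<lambda>n. expectation (Q n))"
      by (rule summable_suminf_not_top[OF EQ0]) (use Q_sum in \<open>auto simp: Q_eq\<close>)
    define q where "q n = real_cond_exp M (F (Suc n)) (Q n)" for n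
    have q_M [measurable]: "q n \<in> borel_measurable M" for n
      unfolding q_def using measurable_from_subalg[OF sub borel_measurable_cond_exp] .
    have q0: "AE \<omega> in M. 0 \<le> q n \<omega>" and q_int: "integrable M (q n)"
      and Eq: "expectation (q n) = expectation (Q n)" for n
    proof -
      interpret S: sigma_finite_subalgebra M "F (Suc n)" using sigma_finite_subalgebraI[OF sub] .
      show "AE \<omega> in M. 0 \<le> q n \<omega>" unfolding q_def by (rule S.real_cond_exp_pos) (use Q0 in auto)
      show "integrable M (q n)" "expectation (q n) = expectation (Q n)"
        unfolding q_def using S.real_cond_exp_int[OF Q_int] by auto
    qed
    \<comment> \<open>Projection preserves expectations, so the expected total of \<open>q\<close>
      equals that of \<open>Q\<close>, which is finite by stopping.\<close>
    have q_summable: "AE \<omega> in M. summable (\<lambda>n. q n \<omega>)"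
    proof -
      have "(\<integral>\<^sup>+\<omega>. (\<Sum>n. ennreal (q n \<omega>)) \<partial>M) = (\<Sum>n. \<integral>\<^sup>+\<omega>. ennreal (q n \<omega>) \<partial>M)"
        by (rule nn_integral_suminf) measurable
      also have "\<dots> = (\<Sum>n. ennreal (expectation (Q n)))"
        by (intro suminf_cong) (use nn_integral_eq_integral[OF q_int q0] Eq in simp)
      also have "\<dots> < \<infinity>" using Q_sum by (simp add: Q_eq)
      finally have "AE \<omega> in M. (\<Sum>n. ennreal (q n \<omega>)) \<noteq> \<infinity>"
        by (intro nn_integral_PInf_AE) auto
      moreover have "AE \<omega> in M. \<forall>n. 0 \<le> q n \<omega>" using q0 by (simp add: AE_all_countable)
      ultimately show ?thesis
        by eventually_elim (auto intro: summable_suminf_not_top)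
    qed
    \<comment> \<open>The scalars are absorbed into the vector, which stays bounded and
      \<open>F n\<close>-measurable as the centring lemma requires.\<close>
    define \<xi> where "\<xi> n \<omega> = inner ((\<tau> n \<omega> * g n) *\<^sub>R u n \<omega>) (e n \<omega>)" for n \<omega>
    have D0: "0 \<le> D" using D[of _ 0] norm_ge_zero order_trans not_empty by blast
    have \<tau>gu: "(\<lambda>\<omega>. (\<tau> n \<omega> * g n) *\<^sub>R u n \<omega>) \<in> borel_measurable (F n)" for n
      using \<tau>_F[of n] u[of n] by measurable
    have \<tau>gu_le: "norm ((\<tau> n \<omega> * g n) *\<^sub>R u n \<omega>) \<le> \<bar>g n\<bar> * D" if "\<omega> \<in> space M" for n \<omega>
      using \<tau>01[of n \<omega>] D[OF that, of n] D0 by (auto simp: mult_left_mono)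
    have \<xi>_int: "integrable M (\<xi> n)" and \<xi>_ce: "AE \<omega> in M. real_cond_exp M (F n) (\<xi> n) \<omega> = 0" for n
      using integrable_inner_bounded[OF sub e e0 \<tau>gu \<tau>gu_le]
        cond_exp_inner_eq_0[OF sub e e0 \<tau>gu \<tau>gu_le] unfolding \<xi>_def by blast+
    have \<xi>_M [measurable]: "\<xi> n \<in> borel_measurable M" for n using \<xi>_int by (rule borel_measurable_integrable)
    have \<xi>2: "(\<xi> n \<omega>)\<^sup>2 \<le> D\<^sup>2 * Q n \<omega>" if "\<omega> \<in> space M" for n \<omega>
    proof -
      have "(inner (u n \<omega>) (e n \<omega>))\<^sup>2 \<le> (norm (u n \<omega>))\<^sup>2 * (norm (e n \<omega>))\<^sup>2"
        using Cauchy_Schwarz_ineq[of "u n \<omega>" "e n \<omega>"] by (simp add: power2_norm_eq_inner)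
      also have "\<dots> \<le> D\<^sup>2 * (norm (e n \<omega>))\<^sup>2"
        using D[OF that, of n] by (intro mult_right_mono power_mono) auto
      finally have "(\<tau> n \<omega> * g n)\<^sup>2 * (inner (u n \<omega>) (e n \<omega>))\<^sup>2 \<le> (\<tau> n \<omega> * g n)\<^sup>2 * (D\<^sup>2 * (norm (e n \<omega>))\<^sup>2)"
        by (rule mult_left_mono) simp
      then show ?thesis using \<tau>01[of n \<omega>] by (auto simp: \<xi>_def Q_def power_mult_distrib mult_ac)
    qed
    have \<xi>2_int: "integrable M (\<lambda>\<omega>. (\<xi> n \<omega>)\<^sup>2)" for n
      by (rule Bochner_Integration.integrable_bound[OF integrable_mult_right[OF Q_int, of "D\<^sup>2"]])
         (use \<xi>2 Q0 in \<open>auto intro!: AE_I2\<close>)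
    have E\<xi>2: "expectation (\<lambda>\<omega>. (\<xi> n \<omega>)\<^sup>2) \<le> D\<^sup>2 * expectation (Q n)" for n
      using integral_mono[OF \<xi>2_int integrable_mult_right[OF Q_int, of "D\<^sup>2"] \<xi>2] by simp
    define d where "d n = real_cond_exp M (F (Suc n)) (\<xi> n)" for n
    have "AE \<omega> in M. summable (\<lambda>n. d n \<omega>)"
    proof (rule L2_martingale_convergence[of F, OF sub filt])
      fix n
      interpret S: sigma_finite_subalgebra M "F n" using sigma_finite_subalgebraI[OF sub] .
      show "d n \<in> borel_measurable (F (Suc n))" unfolding d_def by (rule borel_measurable_cond_exp)
      show "integrable M (\<lambda>\<omega>. (d n \<omega>)\<^sup>2)"
        unfolding d_def by (rule cond_exp_power2_le[OF sub \<xi>_int \<xi>2_int])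
      \<comment> \<open>Tower property: projecting \<open>\<xi> n\<close> first onto
        \<open>F (Suc n)\<close> does not change its projection onto \<open>F n\<close>, which is
        zero.\<close>
      show "AE \<omega> in M. real_cond_exp M (F n) (d n) \<omega> = 0"
        using S.real_cond_exp_nested_subalg[OF sub filt \<xi>_int[of n]] \<xi>_ce[of n]
        unfolding d_def by eventually_elim simp
    next
      show "summable (\<lambda>n. expectation (\<lambda>\<omega>. (d n \<omega>)\<^sup>2))"
      proof (rule summable_comparison_test'[OF summable_mult[OF EQ_sum, of "D\<^sup>2"], of 0])
        fix n
        show "norm (expectation (\<lambda>\<omega>. (d n \<omega>)\<^sup>2)) \<le> D\<^sup>2 * expectation (Q n)"
          using order_trans[OF cond_exp_power2_le(2)[OF sub \<xi>_int \<xi>2_int] E\<xi>2] unfolding d_def by simp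
      qed
    qed
    \<comment> \<open>The stopped domination is projected onto \<open>F (Suc n)\<close>. Its left
      side is measurable there and survives unchanged, while the right side becomes \<open>q\<close>
      and \<open>d\<close>.\<close>
    moreover have "AE \<omega> in M. \<forall>n. \<tau> n \<omega> * \<zeta> n \<omega> \<le> a * q n \<omega> - b * d n \<omega>"
      unfolding AE_all_countable
    proof
      fix n
      interpret S: sigma_finite_subalgebra M "F (Suc n)" using sigma_finite_subalgebraI[OF sub] .
      have [measurable]: "\<zeta> n \<in> borel_measurable M" using \<zeta>(2) by (rule borel_measurable_integrable)
      have \<tau>\<zeta>: "integrable M (\<lambda>\<omega>. \<tau> n \<omega> * \<zeta> n \<omega>)"
      proof (rule Bochner_Integration.integrable_bound[OF \<zeta>(2)[of n]])
        show "AE \<omega> in M. norm (\<tau> n \<omega> * \<zeta> n \<omega>) \<le> norm (\<zeta> n \<omega>)"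
        proof (rule AE_I2)
          show "norm (\<tau> n \<omega> * \<zeta> n \<omega>) \<le> norm (\<zeta> n \<omega>)" for \<omega> using \<tau>01[of n \<omega>] by auto
        qed
      qed measurable
      have aQ: "integrable M (\<lambda>\<omega>. a * Q n \<omega>)" and b\<xi>: "integrable M (\<lambda>\<omega>. b * \<xi> n \<omega>)"
        using Q_int \<xi>_int by auto
      have 1: "AE \<omega> in M. \<tau> n \<omega> * \<zeta> n \<omega> \<le> a * Q n \<omega> - b * \<xi> n \<omega>"
        using \<zeta>_le[of n]
      proof eventually_elim
        case (elim \<omega>)
        then show ?case using \<tau>01[of n \<omega>] by (auto simp: Q_def \<xi>_def)
      qed
      have 2: "AE \<omega> in M. real_cond_exp M (F (Suc n)) (\<lambda>\<omega>. \<tau> n \<omega> * \<zeta> n \<omega>) \<omega>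
          \<le> real_cond_exp M (F (Suc n)) (\<lambda>\<omega>. a * Q n \<omega> - b * \<xi> n \<omega>) \<omega>"
        by (rule S.real_cond_exp_mono[OF 1 \<tau>\<zeta>]) (use aQ b\<xi> in auto)
      have 3: "AE \<omega> in M. real_cond_exp M (F (Suc n)) (\<lambda>\<omega>. \<tau> n \<omega> * \<zeta> n \<omega>) \<omega> = \<tau> n \<omega> * \<zeta> n \<omega>"
        by (rule S.real_cond_exp_F_meas[OF \<tau>\<zeta>]) (intro borel_measurable_times \<tau>_F' \<zeta>)
      show "AE \<omega> in M. \<tau> n \<omega> * \<zeta> n \<omega> \<le> a * q n \<omega> - b * d n \<omega>"
        using 2 3 S.real_cond_exp_diff[OF aQ b\<xi>] S.real_cond_exp_cmult[OF Q_int[of n], of a]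
          S.real_cond_exp_cmult[OF \<xi>_int[of n], of b]
        unfolding q_def d_def by eventually_elim simp
    qed
    ultimately show ?thesis
      using q_summable
    proof eventually_elim
      case (elim \<omega>)
      show ?case
      proof
        assume "\<forall>n. (\<Sum>k\<le>n. c k \<omega>) \<le> of_nat K"
        then have "\<tau> n \<omega> = 1" for n by (simp add: \<tau>_def)
        with elim(2) have "\<forall>n. \<zeta> n \<omega> \<le> a * q n \<omega> - b * d n \<omega>" by simp
        moreover have "summable (\<lambda>n. a * q n \<omega> - b * d n \<omega>)"
          by (intro summable_diff summable_mult elim)
        ultimately show "\<exists>s. summable s \<and> (\<forall>n. \<zeta> n \<omega> \<le> s n)" by blast
      qed
    qed
  qed
  then have "AE \<omega> in M. \<forall>K. (\<forall>n. (\<Sum>k\<le>n. c k \<omega>) \<le> of_nat K) \<longrightarrow> (\<exists>s. summable s \<and> (\<forall>n. \<zeta> n \<omega> \<le> s n))"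
    unfolding AE_all_countable by blast
  with noise show ?thesis
  proof eventually_elim
    case (elim \<omega>)
    then obtain K where K: "(\<Sum>n. c n \<omega>) < of_nat K"
      using ennreal_Ex_less_of_nat unfolding c_def w_def by auto
    have "(\<Sum>k\<le>n. c k \<omega>) \<le> of_nat K" for n
      using sum_le_suminf[of "\<lambda>n. c n \<omega>" "{..n}"] K by (auto intro: order_trans less_imp_le)
    with elim(2) show ?case by blast
  qed
qed

section \<open>The reflected stochastic iteration\<close>

lemma subalgebra_gen_filtration:
  assumes "\<And>k. X k \<in> borel_measurable M"
  shows "subalgebra M (gen_filtration M X n)"
proof -
  have *: "(\<Union>i\<in>{..n}. {X i -` U \<inter> space M | U. U \<in> sets borel}) \<subseteq> sets M"
    using assms by (auto intro: measurable_sets)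
  moreover have "sets M \<subseteq> Pow (space M)" using sets.space_closed by blast
  ultimately show ?thesis
    unfolding subalgebra_def gen_filtration_def
    by (simp add: space_measure_of_conv sets_measure_of_conv sets.sigma_sets_subset)
qed

lemma measurable_gen_filtration:
  assumes "k \<le> n"
  shows "X k \<in> borel_measurable (gen_filtration M X n)"
proof (rule measurableI)
  fix U :: "'b set" assume "U \<in> sets borel"
  let ?G = "\<Union>i\<in>{..n}. {X i -` U \<inter> space M | U. U \<in> sets borel}"
  have "X k -` U \<inter> space M \<in> ?G" using assms \<open>U \<in> sets borel\<close> by blast
  moreover have "?G \<subseteq> Pow (space M)" by auto
  ultimately show "X k -` U \<inter> space (gen_filtration M X n) \<in> sets (gen_filtration M X n)"
    unfolding gen_filtration_def by (simp add: space_measure_of_conv)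
qed simp

lemma subalgebra_gen_filtration_Suc:
  "subalgebra (gen_filtration M X (Suc n)) (gen_filtration M X n)"
proof -
  have "(\<Union>i\<in>{..n}. {X i -` U \<inter> space M | U. U \<in> sets borel})
    \<subseteq> (\<Union>i\<in>{..Suc n}. {X i -` U \<inter> space M | U. U \<in> sets borel})"
    by (intro UN_mono) auto
  moreover have "(\<Union>i\<in>{..m}. {X i -` U \<inter> space M | U. U \<in> sets borel}) \<subseteq> Pow (space M)" for m
    by auto
  ultimately show ?thesis
    unfolding subalgebra_def gen_filtration_def
    by (simp add: space_measure_of_conv sets_measure_of_conv sigma_sets_mono')
qed

lemma (in prob_space) is_cond_exp_residual:
  fixes X Y :: "'a \<Rightarrow> 'b::{banach, second_countable_topology}"
  assumes G: "subalgebra M G" and ce: "is_cond_exp M G X Y" and Y: "Y \<in> borel_measurable M"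
  shows "integrable M (\<lambda>\<omega>. X \<omega> - Y \<omega>)"
    and "S \<in> sets G \<Longrightarrow> (LINT \<omega>:S|M. X \<omega> - Y \<omega>) = 0"
proof -
  obtain Z where X: "integrable M X" and Z: "integrable M Z" and YZ: "AE \<omega> in M. Y \<omega> = Z \<omega>"
    and eq: "\<And>S. S \<in> sets G \<Longrightarrow> (LINT \<omega>:S|M. X \<omega>) = (LINT \<omega>:S|M. Z \<omega>)"
    using ce unfolding is_cond_exp_def by blast
  have Yi: "integrable M Y" by (rule integrable_cong_AE_imp[OF Z Y]) (use YZ in auto)
  then show "integrable M (\<lambda>\<omega>. X \<omega> - Y \<omega>)" using X by simp
  assume S: "S \<in> sets G"
  then have SM: "S \<in> sets M" using G by (auto simp: subalgebra_def)
  have "(LINT \<omega>:S|M. X \<omega> - Y \<omega>) = (LINT \<omega>:S|M. X \<omega>) - (LINT \<omega>:S|M. Y \<omega>)"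
    using X Yi SM by (intro set_integral_diff) (simp_all add: set_integrable_def integrable_mult_indicator)
  also have "(LINT \<omega>:S|M. Y \<omega>) = (LINT \<omega>:S|M. Z \<omega>)"
    unfolding set_lebesgue_integral_def
    using YZ Y Z SM by (intro integral_cong_AE) auto
  finally show "(LINT \<omega>:S|M. X \<omega> - Y \<omega>) = 0" using eq[OF S] by simp
qed

theorem mainTheorem5:
  fixes M :: "'w measure"
    and A :: "'a::{real_inner, banach, second_countable_topology} \<Rightarrow> 'a set"
    and B :: "'a \<Rightarrow> 'a"
    and \<mu> :: real
    and \<gamma> :: "nat \<Rightarrow> real" and \<gamma>m1 :: real
    and x :: "nat \<Rightarrow> 'w \<Rightarrow> 'a" and xm1 :: "'w \<Rightarrow> 'a"
    and y :: "nat \<Rightarrow> 'w \<Rightarrow> 'a" and r :: "nat \<Rightarrow> 'w \<Rightarrow> 'a"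
  assumes P: "prob_space M"
    and A_mm: "maximally_monotone A"
    and B_mono: "monotone_op (single_op B)"
    and mu_pos: "\<mu> > 0"
    and B_lip: "\<mu>-lipschitz_on UNIV B"
    and zer_ne: "zer_sum A B \<noteq> {}"
    and dom_bdd: "bounded (dom_op A)"
    and unif: "uniformly_monotone A \<or> uniformly_monotone (single_op B)"
    and gam_range: "\<forall>n. 0 < \<gamma> n \<and> \<gamma> n < (sqrt 2 - 1) / \<mu>"
    and gam_m1: "0 < \<gamma>m1 \<and> \<gamma>m1 < (sqrt 2 - 1) / \<mu>"
    and gam_dec: "decseq \<gamma>" and gam_dec_m1: "\<gamma> 0 \<le> \<gamma>m1"
    and gam_sq: "summable (\<lambda>n. (\<gamma> n)\<^sup>2)"
    and gam_div: "\<not> summable \<gamma>"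
    and x0_rv: "x 0 \<in> borel_measurable M" and x0_L2: "integrable M (\<lambda>\<omega>. (norm (x 0 \<omega>))\<^sup>2)"
    and xm1_rv: "xm1 \<in> borel_measurable M" and xm1_L2: "integrable M (\<lambda>\<omega>. (norm (xm1 \<omega>))\<^sup>2)"
    and y_def: "\<forall>n \<omega>. y n \<omega> = 2 *\<^sub>R x n \<omega> - (if n = 0 then xm1 \<omega> else x (n - 1) \<omega>)"
    and r_rv: "\<forall>n. r n \<in> borel_measurable M"
    and r_ce: "\<forall>n. is_cond_exp M (gen_filtration M x n) (r n) (\<lambda>\<omega>. B (y n \<omega>))"
    and noise: "AE \<omega> in M. (\<Sum>n. ennreal ((\<gamma> n)\<^sup>2) *
                  nn_cond_exp M (gen_filtration M x n)
                    (\<lambda>\<omega>'. ennreal ((norm (r n \<omega>' - B (y n \<omega>')))\<^sup>2)) \<omega>) < \<infinity>"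
    and iter: "\<forall>n. \<forall>\<omega>\<in>space M. x (Suc n) \<omega> = resolvent (\<gamma> n) A (x n \<omega> - \<gamma> n *\<^sub>R r n \<omega>)"
  shows "\<exists>xbar. zer_sum A B = {xbar} \<and> (AE \<omega> in M. (\<lambda>n. x n \<omega>) \<longlonglongrightarrow> xbar)"
proof -
  interpret prob_space M by (rule P)
  have A_mono: "monotone_op A" using A_mm by (simp add: maximally_monotone_def)
  obtain \<psi> :: "real \<Rightarrow> real" where \<psi>: "mono \<psi>" "\<And>t. 0 \<le> \<psi> t" "\<And>t. \<psi> t \<le> 1" "\<And>t. 0 < t \<Longrightarrow> 0 < \<psi> t"
    and \<psi>_AB: "\<And>x y u v. u \<in> A x \<Longrightarrow> v \<in> A y \<Longrightarrow> \<psi> (norm (x - y)) \<le> inner (x - y) ((u + B x) - (v + B y))"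
    using uniformly_monotone_sum_real[OF A_mono B_mono unif] by blast
  obtain z where z: "z \<in> zer_sum A B" using zer_ne by blast
  have zer_iff: "p \<in> zer_sum A B \<longleftrightarrow> - B p \<in> A p" for p
    by (auto simp: zer_sum_def add_eq_0_iff2)
  \<comment> \<open>For two zeros both values of \<open>A + B\<close> can be taken to be 0, so the
    modulus at their distance is at most 0.\<close>
  have "p = z" if "p \<in> zer_sum A B" for p
    using \<psi>_AB[of "- B p" p "- B z" z] that z \<psi>(4)[of "norm (p - z)"] by (force simp: zer_iff)
  then have unique: "zer_sum A B = {z}" using z by blast
  have zA: "- B z \<in> A z" using z by (simp add: zer_iff)

  have lip: "norm (B p - B q) \<le> \<mu> * norm (p - q)" for p q
    using lipschitz_onD[OF B_lip, of p q] by (simp add: dist_norm)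
  have B_meas [measurable]: "B \<in> borel_measurable borel"
    using lipschitz_on_continuous_on[OF B_lip] by (rule borel_measurable_continuous_onI)
  have \<psi>_meas [measurable]: "\<psi> \<in> borel_measurable borel" using \<psi>(1) by (rule borel_measurable_mono)
  have \<gamma>_pos: "0 < \<gamma> n" for n using gam_range by blast
  have res_meas: "resolvent (\<gamma> n) A \<in> borel_measurable borel" for n
  proof (rule borel_measurable_continuous_onI)
    have "1-lipschitz_on UNIV (resolvent (\<gamma> n) A)"
      using resolvent_nonexpansive[OF A_mm \<gamma>_pos] by (intro lipschitz_onI) (auto simp: dist_norm)
    then show "continuous_on UNIV (resolvent (\<gamma> n) A)" by (rule lipschitz_on_continuous_on)
  qed
  have x_M [measurable]: "x n \<in> borel_measurable M" for n
  proof (induction n)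
    case (Suc n)
    have [measurable]: "r n \<in> borel_measurable M" using r_rv by blast
    note Suc[measurable] res_meas[measurable]
    have "(\<lambda>\<omega>. resolvent (\<gamma> n) A (x n \<omega> - \<gamma> n *\<^sub>R r n \<omega>)) \<in> borel_measurable M" by measurable
    then show ?case using iter by (subst measurable_cong) auto
  qed (rule x0_rv)
  have y_Suc: "y (Suc n) \<omega> = 2 *\<^sub>R x (Suc n) \<omega> - x n \<omega>" for n \<omega> using y_def by simp
  have step_mem: "(1 / \<gamma> n) *\<^sub>R (x n \<omega> - \<gamma> n *\<^sub>R r n \<omega> - x (Suc n) \<omega>) \<in> A (x (Suc n) \<omega>)"
    if "\<omega> \<in> space M" for n \<omega>
    using resolvent_mem[OF A_mm \<gamma>_pos] iter that by metis
  obtain D0 where D0: "\<And>p. p \<in> dom_op A \<Longrightarrow> norm p \<le> D0" using dom_bdd by (auto simp: bounded_iff)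
  define D where "D = D0 + norm z"
  \<comment> \<open>Values of the resolvent lie in \<open>dom_op A\<close>. The bound is uniform in
    \<open>\<omega>\<close>, so it controls the multiplier \<open>u\<close> of the noise and makes
    \<open>\<zeta>\<close> integrable.\<close>
  have x_D: "norm (x (Suc n) \<omega> - z) \<le> D" if "\<omega> \<in> space M" for n \<omega>
  proof -
    have "x (Suc n) \<omega> \<in> dom_op A" using step_mem[OF that, of n] by (auto simp: dom_op_def)
    from D0[OF this] norm_triangle_ineq4[of "x (Suc n) \<omega>" z] show ?thesis by (simp add: D_def)
  qed

  \<comment> \<open>Only from index 2 on are \<open>x n\<close> and its predecessor both in the bounded domain of \<open>A\<close>.\<close>
  define F where "F n = gen_filtration M x (n + 2)" for n
  define e where "e n \<omega> = r (n + 2) \<omega> - B (y (n + 2) \<omega>)" for n \<omega>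
  define g where "g n = \<gamma> (n + 2)" for n
  define u where "u n \<omega> = x (n + 2) \<omega> - z" for n \<omega>
  define \<delta> where "\<delta> n \<omega> = norm (x (n + 2) \<omega> - x (n + 1) \<omega>)" for n \<omega>
  \<comment> \<open>This is the energy inequality without its two noise terms. It involves iterates
    up to index \<open>n + 3\<close> only, hence is \<open>F (Suc n)\<close>-measurable even if
    \<open>e n\<close> is not.\<close>
  define \<zeta> where "\<zeta> n \<omega> = (norm (u (Suc n) \<omega>))\<^sup>2 + (\<delta> (Suc n) \<omega>)\<^sup>2 / 2
    + 2 * g n * \<psi> (norm (u (Suc n) \<omega>)) - (norm (u n \<omega>))\<^sup>2 - (\<delta> n \<omega>)\<^sup>2 / 4
    - 8 * (g n)\<^sup>2 * D\<^sup>2 * \<mu>\<^sup>2" for n \<omega>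
  have sub: "subalgebra M (F n)" and filt: "subalgebra (F (Suc n)) (F n)" for n
    unfolding F_def by (auto intro: subalgebra_gen_filtration x_M subalgebra_gen_filtration_Suc)
  have x_F: "x k \<in> borel_measurable (F n)" if "k \<le> n + 2" for k n
    unfolding F_def by (rule measurable_gen_filtration[OF that])
  have u_F: "u n \<in> borel_measurable (F n)" and u_F': "u n \<in> borel_measurable (F (Suc n))" for n
    using x_F[of "n + 2" n] x_F[of "n + 2" "Suc n"] unfolding u_def by measurable
  have \<delta>_F: "\<delta> n \<in> borel_measurable (F n)" and \<delta>_F': "\<delta> n \<in> borel_measurable (F (Suc n))" for n
    using x_F[of "n + 2" n] x_F[of "n + 1" n] x_F[of "n + 2" "Suc n"] x_F[of "n + 1" "Suc n"]
    unfolding \<delta>_def by measurable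
  have u_D: "norm (u n \<omega>) \<le> D" if "\<omega> \<in> space M" for n \<omega>
    using x_D[OF that, of "n + 1"] by (simp add: u_def)
  have \<delta>_D: "\<delta> n \<omega> \<le> 2 * D" if "\<omega> \<in> space M" for n \<omega>
  proof -
    have "\<delta> n \<omega> = norm ((x (Suc (Suc n)) \<omega> - z) - (x (Suc n) \<omega> - z))" by (simp add: \<delta>_def)
    also have "\<dots> \<le> 2 * D"
      using norm_triangle_ineq4[of "x (Suc (Suc n)) \<omega> - z" "x (Suc n) \<omega> - z"] x_D[OF that, of n] x_D[OF that, of "Suc n"]
      by linarith
    finally show ?thesis .
  qed
  have \<zeta>_F: "\<zeta> n \<in> borel_measurable (F (Suc n))" for n
    using u_F[of "Suc n"] u_F'[of n] \<delta>_F[of "Suc n"] \<delta>_F'[of n] unfolding \<zeta>_def by measurable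
  have \<zeta>_int: "integrable M (\<zeta> n)" for n
  proof -
    have [measurable]: "u k \<in> borel_measurable M" "\<delta> k \<in> borel_measurable M" for k
      using measurable_from_subalg[OF sub] u_F \<delta>_F by blast+
    have u2: "integrable M (\<lambda>\<omega>. (norm (u k \<omega>))\<^sup>2)" for k
      by (rule integrable_const_bound[of _ "D\<^sup>2"]) (auto intro!: AE_I2 power_mono u_D)
    have \<delta>2_le: "(\<delta> k \<omega>)\<^sup>2 \<le> (2 * D)\<^sup>2" if "\<omega> \<in> space M" for k \<omega>
      using \<delta>_D[OF that] by (rule power_mono) (simp add: \<delta>_def)
    have \<delta>2: "integrable M (\<lambda>\<omega>. (\<delta> k \<omega>)\<^sup>2)" for k
      by (rule integrable_const_bound[of _ "(2 * D)\<^sup>2"])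
         (use \<delta>2_le in \<open>auto intro!: AE_I2 simp del: power_mult_distrib\<close>)
    have \<psi>i: "integrable M (\<lambda>\<omega>. \<psi> (norm (u k \<omega>)))" for k
      by (rule integrable_const_bound[of _ 1]) (use \<psi>(2,3) in auto)
    show ?thesis unfolding \<zeta>_def
      by (intro Bochner_Integration.integrable_diff Bochner_Integration.integrable_add
          integrable_mult_right integrable_divide u2 \<delta>2 \<psi>i integrable_const)
  qed
  have \<zeta>_le: "\<zeta> n \<omega> \<le> 4 * (g n)\<^sup>2 * (norm (e n \<omega>))\<^sup>2 - 2 * g n * inner (u n \<omega>) (e n \<omega>)"
    if "\<omega> \<in> space M" for n \<omega>
    using reflected_step_energy[of A \<psi> B \<mu> "g n" z "x (n + 2) \<omega>" "r (n + 2) \<omega>" "x (n + 3) \<omega>" D "x (n + 1) \<omega>",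
        OF \<psi>_AB lip _ _ zA] mu_pos \<gamma>_pos[of "n + 2"] step_mem[OF that, of "n + 2"] x_D[OF that, of "n + 2"] y_Suc[of "Suc n" \<omega>]
    by (simp add: \<zeta>_def g_def u_def \<delta>_def e_def eval_nat_numeral)
  have y_M: "(\<lambda>\<omega>. B (y n \<omega>)) \<in> borel_measurable M" for n
  proof -
    have "y n = (\<lambda>\<omega>. 2 *\<^sub>R x n \<omega> - (if n = 0 then xm1 \<omega> else x (n - 1) \<omega>))" using y_def by auto
    then have "y n \<in> borel_measurable M" using xm1_rv by simp
    then show ?thesis by measurable
  qed
  have ce: "is_cond_exp M (F n) (r (n + 2)) (\<lambda>\<omega>. B (y (n + 2) \<omega>))" for n
    unfolding F_def using r_ce by blast
  have e_int: "integrable M (e n)" and e0: "S \<in> sets (F n) \<Longrightarrow> (LINT \<omega>:S|M. e n \<omega>) = 0" for n S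
    unfolding e_def using is_cond_exp_residual[OF sub ce y_M] by blast+
  have noise': "AE \<omega> in M. (\<Sum>n. ennreal ((g n)\<^sup>2) *
      nn_cond_exp M (F n) (\<lambda>\<omega>'. ennreal ((norm (e n \<omega>'))\<^sup>2)) \<omega>) < \<infinity>"
    using noise
  proof eventually_elim
    case (elim \<omega>)
    define f where "f n = ennreal ((\<gamma> n)\<^sup>2) * nn_cond_exp M (gen_filtration M x n)
      (\<lambda>\<omega>'. ennreal ((norm (r n \<omega>' - B (y n \<omega>')))\<^sup>2)) \<omega>" for n
    have "(\<Sum>n. f (n + 2)) \<le> (\<Sum>n. f n)" using suminf_offset[of f 2] by simp
    with elim show ?case by (simp add: f_def g_def F_def e_def)
  qed
  have "AE \<omega> in M. \<exists>s. summable s \<and> (\<forall>n. \<zeta> n \<omega> \<le> s n)"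
    by (rule AE_summable_dominating_noise[of F e u D g, OF sub filt e_int e0 u_F u_D noise' \<zeta>_F \<zeta>_int AE_I2[OF \<zeta>_le]])
  then have "AE \<omega> in M. (\<lambda>n. x n \<omega>) \<longlonglongrightarrow> z"
  proof eventually_elim
    case (elim \<omega>)
    then obtain s where s: "summable s" "\<And>n. \<zeta> n \<omega> \<le> s n" by blast
    have "(\<lambda>n. norm (u n \<omega>)) \<longlonglongrightarrow> 0"
    proof (rule quasi_fejer_modulus_tendsto_0[OF \<psi>(1,2,4)])
      \<comment> \<open>The deterministic error subtracted in \<open>\<zeta>\<close> returns here as
        a summable multiple of \<open>(g n)\<^sup>2\<close>.\<close>
      show "(norm (u (Suc n) \<omega>))\<^sup>2 + (\<delta> (Suc n) \<omega>)\<^sup>2 / 2 + 2 * g n * \<psi> (norm (u (Suc n) \<omega>))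
        \<le> (norm (u n \<omega>))\<^sup>2 + (\<delta> n \<omega>)\<^sup>2 / 4 + (s n + 8 * D\<^sup>2 * \<mu>\<^sup>2 * (g n)\<^sup>2)" for n
        using s(2)[of n] by (simp add: \<zeta>_def algebra_simps)
      have "summable (\<lambda>n. (g n)\<^sup>2)" using gam_sq unfolding g_def by (rule summable_ignore_initial_segment)
      then show "summable (\<lambda>n. s n + 8 * D\<^sup>2 * \<mu>\<^sup>2 * (g n)\<^sup>2)"
        by (intro summable_add s summable_mult)
      show "\<not> summable g" using gam_div summable_iff_shift[of \<gamma> 2] unfolding g_def by blast
    qed (auto simp: g_def \<gamma>_pos)
    then have "(\<lambda>n. x (n + 2) \<omega> - z) \<longlonglongrightarrow> 0" unfolding u_def by (rule tendsto_norm_zero_cancel)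
    then have "(\<lambda>n. x (n + 2) \<omega>) \<longlonglongrightarrow> z" by (rule LIM_zero_cancel)
    then show ?case by (rule LIMSEQ_offset)
  qed
  with unique show ?thesis by blast
qed

end
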